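(* Let $G\subseteq S_n$ be a permutation group containing the cycle $(1\,2\,\dots\,n)$, acting on $\mathbb Q^n$ by permuting coordinates. Let $\vec\delta\in\mathbb Q^n$, and let $V_\delta$ be the minimal $G$-invariant subspace of $\mathbb Q^n$ containing $\vec\delta$. Then $$V_\delta=\bigoplus_{d} U_d,$$ where $d$ runs over those $d\in D(G)$ for which there exists $r\in\Psi_d$ with $(\vec\delta,\vec w_r)\neq0$.
   Context: For a divisor $d$ of $n$, $V_d\subset\mathbb Q^n$ is the subspace of $d$-periodic vectors $(v_1,\dots,v_d,v_1,\dots,v_d,\dots,v_1,\dots,v_d)$. $D(G)$ is the set of divisors $d$ of $n$ such that $V_d$ is $G$-invariant; equivalently, the residue classes mod $d$ form a block system of $G$. For $d,\tilde d\in D(G)$, $d$ covers $\tilde d$ if $\tilde d\mid d$, $\tilde d<d$, and there is no $l\in D(G)$ with $\tilde d<l<d$, $\tilde d\mid l$, $l\mid d$. For $d\in D(G)$ let $U_d=V_d\cap V_{d_1}^\perp\cap\dots\cap V_{d_\ell}^\perp$, where $d_1,\dots,d_\ell$ are all elements of $D(G)$ covered by $d$ and $\perp$ is taken with respect to the standard scalar product. Let $\varepsilon_n=e^{2\pi i/n}$ and $\vec w_k=(1,\varepsilon_n^k,\varepsilon_n^{2k},\dots,\varepsilon_n^{(n-1)k})$ for $1\le k\le n$. The pairing $(\cdot,\cdot)$ is the standard Hermitian product on $\mathbb C^n$. For $d\in D(G)$, $\Psi_d$ is the set of $r\in\{1,\dots,n\}$ such that $n/d$ divides $r$ but $n/\tilde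 d$ does not divide $r$ for every $\tilde d\in D(G)$ covered by $d$. *)

theory Defs
  imports Complex_Main "HOL-Algebra.Sym_Groups"
begin

definition Qvec :: "nat \<Rightarrow> (nat \<Rightarrow> rat) set" where
  "Qvec n = {v. \<forall>i. i \<notin> {1..n} \<longrightarrow> v i = 0}"

definition qsubspace :: "nat \<Rightarrow> (nat \<Rightarrow> rat) set \<Rightarrow> bool" where
  "qsubspace n W \<longleftrightarrow> W \<subseteq> Qvec n \<and> (\<lambda>i. 0) \<in> W
     \<and> (\<forall>v\<in>W. \<forall>w\<in>W. (\<lambda>i. v i + w i) \<in> W)
     \<and> (\<forall>c. \<forall>v\<in>W. (\<lambda>i. c * v i) \<in> W)"

definition perm_act :: "(nat \<Rightarrow> nat) \<Rightarrow> (nat \<Rightarrow> rat) \<Rightarrow> (nat \<Rightarrow> rat)" where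
  "perm_act \<sigma> v = (\<lambda>i. v (inv_into UNIV \<sigma> i))"

definition G_invariant :: "(nat \<Rightarrow> nat) set \<Rightarrow> (nat \<Rightarrow> rat) set \<Rightarrow> bool" where
  "G_invariant G W \<longleftrightarrow> (\<forall>\<sigma>\<in>G. \<forall>v\<in>W. perm_act \<sigma> v \<in> W)"

definition ncycle :: "nat \<Rightarrow> nat \<Rightarrow> nat" where
  "ncycle n i = (if 1 \<le> i \<and> i < n then i + 1 else if i = n then 1 else i)"

definition V_delta :: "nat \<Rightarrow> (nat \<Rightarrow> nat) set \<Rightarrow> (nat \<Rightarrow> rat) \<Rightarrow> (nat \<Rightarrow> rat) set" where
  "V_delta n G \<delta> = \<Inter> {W. qsubspace n W \<and> G_invariant G W \<and> \<delta> \<in> W}"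

definition Vper :: "nat \<Rightarrow> nat \<Rightarrow> (nat \<Rightarrow> rat) set" where
  "Vper n d = {v \<in> Qvec n. \<forall>i\<in>{1..n}. v i = v (((i - 1) mod d) + 1)}"

definition DG :: "nat \<Rightarrow> (nat \<Rightarrow> nat) set \<Rightarrow> nat set" where
  "DG n G = {d. d dvd n \<and> G_invariant G (Vper n d)}"

definition covers :: "nat \<Rightarrow> (nat \<Rightarrow> nat) set \<Rightarrow> nat \<Rightarrow> nat \<Rightarrow> bool" where
  "covers n G d d' \<longleftrightarrow> d' dvd d \<and> d' < d \<and>
     \<not> (\<exists>l\<in>DG n G. d' < l \<and> l < d \<and> d' dvd l \<and> l dvd d)"

definition qinner :: "nat \<Rightarrow> (nat \<Rightarrow> rat) \<Rightarrow> (nat \<Rightarrow> rat) \<Rightarrow> rat" where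
  "qinner n v w = (\<Sum>i=1..n. v i * w i)"

definition Ud :: "nat \<Rightarrow> (nat \<Rightarrow> nat) set \<Rightarrow> nat \<Rightarrow> (nat \<Rightarrow> rat) set" where
  "Ud n G d = {v \<in> Vper n d. \<forall>d'\<in>DG n G. covers n G d d' \<longrightarrow>
                 (\<forall>w\<in>Vper n d'. qinner n v w = 0)}"

definition eps :: "nat \<Rightarrow> complex" where
  "eps n = cis (2 * pi / real n)"

definition wvec :: "nat \<Rightarrow> nat \<Rightarrow> nat \<Rightarrow> complex" where
  "wvec n k i = eps n ^ ((i - 1) * k)"

definition herm :: "nat \<Rightarrow> (nat \<Rightarrow> rat) \<Rightarrow> (nat \<Rightarrow> complex) \<Rightarrow> complex" where
  "herm n v w = (\<Sum>i=1..n. of_rat (v i) * cnj (w i))"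

definition Psi :: "nat \<Rightarrow> (nat \<Rightarrow> nat) set \<Rightarrow> nat \<Rightarrow> nat set" where
  "Psi n G d = {r \<in> {1..n}. (n div d) dvd r \<and>
      (\<forall>d'\<in>DG n G. covers n G d d' \<longrightarrow> \<not> (n div d') dvd r)}"

end

theory Submission
  imports Defs "HOL-Computational_Algebra.Computational_Algebra" "HOL-Number_Theory.Cong"
    "HOL-Library.Periodic_Fun"
begin

text \<open>A rational vector is a function on the integers modulo \<open>n\<close>, and a subspace \<open>W\<close> that is
  invariant under \<open>G\<close>, hence under the full cycle, is an ideal of the rational group ring. As
  \<open>X ^ n - 1\<close> is separable, \<open>W\<close> is generated by an idempotent \<open>e\<close>. The Frobenius congruence for
  large primes shows that \<open>e x\<close> only depends on \<open>gcd x n\<close>. In particular the projection onto \<open>W\<close>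
  with kernel \<open>e (i - j)\<close> is symmetric, and hence commutes with \<open>G\<close>. So \<open>e\<close> lies in the S-ring of
  functions \<open>f\<close> such that \<open>f x\<close> only depends on \<open>gcd x n\<close> and \<open>f (i - j)\<close> is \<open>G\<close>-invariant. By a
  theorem of Muzychuk such an S-ring is spanned by the indicator functions of the subgroups it
  contains, which here belong to the elements of \<open>D(G)\<close>. Therefore the Fourier transform of \<open>e\<close>,
  whose values are 0 and 1, is constant on each \<open>\<Psi>\<^sub>d\<close>. If some vector of \<open>W\<close> has a nonzero
  coefficient in \<open>\<Psi>\<^sub>d\<close>, this constant is 1, and \<open>U\<^sub>d\<close>, which consists of the vectors with
  Fourier support in \<open>\<Psi>\<^sub>d\<close>, is contained in \<open>W\<close>.\<close>

section \<open>Periodic functions and convolution\<close>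

definition periodic :: "int \<Rightarrow> (int \<Rightarrow> 'a) \<Rightarrow> bool" where
  "periodic n f \<longleftrightarrow> (\<forall>x. f (x + n) = f x)"

lemma periodicD:
  assumes "periodic n f" and "n dvd x - y"
  shows "f x = f y"
proof -
  interpret periodic_fun_simple f n
    using assms(1) by unfold_locales (simp add: periodic_def)
  obtain k where "x = y + of_int k * n"
    using assms(2) by (auto simp: dvd_def algebra_simps)
  then show ?thesis using plus_of_int[of y k] by simp
qed

lemma periodic_mod: "periodic n f \<Longrightarrow> f (x mod n) = f x"
  by (erule periodicD) (metis mod_eq_dvd_iff mod_mod_trivial)

lemma periodic_dvd: "periodic m f \<Longrightarrow> m dvd n \<Longrightarrow> periodic n f"
  unfolding periodic_def [of n] by (auto intro: periodicD)

lemma periodic_mult: "periodic n f \<Longrightarrow> periodic n g \<Longrightarrow> periodic n (\<lambda>x. f x * g x)"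
  by (simp add: periodic_def)

lemma periodic_comp: "periodic n f \<Longrightarrow> periodic n (\<lambda>x. \<Phi> (f x))"
  by (simp add: periodic_def)

lemma periodic_shift: "periodic n f \<Longrightarrow> periodic n (\<lambda>x. f (x - c))"
  by (auto simp: periodic_def add_diff_eq [symmetric] intro: periodicD)

lemma periodic_reflect: "periodic n f \<Longrightarrow> periodic n (\<lambda>x. f (c - x))"
  unfolding periodic_def [of n "\<lambda>x. f (c - x)"] by (auto intro: periodicD)

lemma sum_periodic_reindex:
  fixes n :: int
  assumes n_pos: "0 < n" and h_periodic: "periodic n h" and finite_A: "finite A"
    and card_A: "card A = nat n"
    and inj_cong: "\<And>a b. a \<in> A \<Longrightarrow> b \<in> A \<Longrightarrow> n dvd \<phi> a - \<phi> b \<Longrightarrow> a = b"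
  shows "(\<Sum>a\<in>A. h (\<phi> a)) = (\<Sum>y\<in>{0..<n}. h y)"
proof -
  have inj_mod: "inj_on (\<lambda>a. \<phi> a mod n) A"
    by (rule inj_onI) (metis inj_cong mod_eq_dvd_iff)
  have "(\<lambda>a. \<phi> a mod n) ` A = {0..<n}"
    by (rule card_subset_eq) (use n_pos finite_A card_A inj_mod in \<open>auto simp: card_image\<close>)
  with inj_mod have bij_mod: "bij_betw (\<lambda>a. \<phi> a mod n) A {0..<n}" by (simp add: bij_betw_def)
  have "(\<Sum>a\<in>A. h (\<phi> a)) = (\<Sum>a\<in>A. h (\<phi> a mod n))"
    by (simp add: periodic_mod [OF h_periodic])
  also have "\<dots> = (\<Sum>y\<in>{0..<n}. h y)"
    by (rule sum.reindex_bij_betw [OF bij_mod])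
  finally show ?thesis .
qed

lemma eq_if_dvd_diff_atLeastLessThan:
  fixes n :: int
  shows "a \<in> {c..<c + n} \<Longrightarrow> b \<in> {c..<c + n} \<Longrightarrow> n dvd a - b \<Longrightarrow> a = b"
  using zdvd_not_zless [of "a - b" n] zdvd_not_zless [of "b - a" n]
  by (cases a b rule: linorder_cases) (auto simp: dvd_diff_commute)

lemma sum_periodic_affine:
  fixes n :: int
  assumes n_pos: "0 < n" and h_periodic: "periodic n h" and u_coprime: "coprime u n"
  shows "(\<Sum>y\<in>{0..<n}. h (u * y + c)) = (\<Sum>y\<in>{0..<n}. h y)"
proof (rule sum_periodic_reindex [OF n_pos h_periodic])
  fix a b assume a_range: "a \<in> {0..<n}" and b_range: "b \<in> {0..<n}"
    and n_dvd_diff: "n dvd (u * a + c) - (u * b + c)"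
  then have "n dvd u * (a - b)" by (simp add: algebra_simps)
  then have "n dvd a - b" using u_coprime by (simp add: coprime_commute coprime_dvd_mult_right_iff)
  then show "a = b" using a_range b_range n_dvd_diff eq_if_dvd_diff_atLeastLessThan [of a 0 n b]
    by simp
qed (use n_pos in auto)

lemma sum_periodic_dvd:
  fixes h :: "int \<Rightarrow> 'a :: comm_ring_1"
  assumes m_pos: "0 < m" and n_nonneg: "0 \<le> n" and m_dvd_n: "m dvd n" and h_periodic: "periodic m h"
  shows "(\<Sum>y\<in>{0..<n}. h y) = of_int (n div m) * (\<Sum>y\<in>{0..<m}. h y)"
proof -
  have "(\<Sum>y\<in>{0..<m * int c}. h y) = of_nat c * (\<Sum>y\<in>{0..<m}. h y)" for c
  proof (induction c)
    case (Suc c)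
    have "{0..<m * int (Suc c)} = {0..<m * int c} \<union> {m * int c..<m * int c + m}"
      using ivl_disj_un_two(3) [of 0 "m * int c" "m * int c + m"] m_pos by (simp add: algebra_simps)
    then have "(\<Sum>y\<in>{0..<m * int (Suc c)}. h y)
        = (\<Sum>y\<in>{0..<m * int c}. h y) + (\<Sum>y\<in>{m * int c..<m * int c + m}. h y)"
      by (simp add: sum.union_disjoint)
    also have "(\<Sum>y\<in>{m * int c..<m * int c + m}. h y) = (\<Sum>y\<in>{0..<m}. h y)"
      by (rule sum_periodic_reindex [OF m_pos h_periodic])
        (auto intro: eq_if_dvd_diff_atLeastLessThan)
    finally show ?case using Suc.IH by (simp add: algebra_simps)
  qed simp
  from this [of "nat (n div m)"] show ?thesis
    using m_pos n_nonneg m_dvd_n by (simp add: pos_imp_zdiv_nonneg_iff)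
qed

definition conv :: "int \<Rightarrow> (int \<Rightarrow> 'a) \<Rightarrow> (int \<Rightarrow> 'a) \<Rightarrow> int \<Rightarrow> 'a :: comm_ring_1" where
  "conv n f g x = (\<Sum>y\<in>{0..<n}. f y * g (x - y))"

definition delta :: "int \<Rightarrow> int \<Rightarrow> 'a :: comm_ring_1" where
  "delta n x = of_bool (n dvd x)"

primrec convpow :: "int \<Rightarrow> (int \<Rightarrow> 'a) \<Rightarrow> nat \<Rightarrow> int \<Rightarrow> 'a :: comm_ring_1" where
  "convpow n f 0 = delta n"
| "convpow n f (Suc k) = conv n f (convpow n f k)"

lemma periodic_delta: "periodic n (delta n)"
  by (simp add: periodic_def delta_def)

lemma delta_minus_commute: "delta n (x - y) = delta n (y - x)"
  by (simp add: delta_def dvd_diff_commute)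

lemma sum_delta_periodic:
  fixes f :: "int \<Rightarrow> 'a :: comm_ring_1"
  assumes n_pos: "0 < n" and f_periodic: "periodic n f"
  shows "(\<Sum>y\<in>{0..<n}. f y * delta n (y - z)) = f z"
proof -
  have "(\<Sum>y\<in>{0..<n}. f y * delta n (y - z)) = (\<Sum>y\<in>{0..<n}. if y = z mod n then f y else 0)"
  proof (rule sum.cong)
    fix y assume "y \<in> {0..<n}"
    then have "n dvd y - z \<longleftrightarrow> y = z mod n"
      by (metis atLeastLessThan_iff mod_eq_dvd_iff mod_pos_pos_trivial)
    then show "f y * delta n (y - z) = (if y = z mod n then f y else 0)" by (simp add: delta_def)
  qed simp
  also have "\<dots> = f z" using n_pos by (simp add: periodic_mod [OF f_periodic])
  finally show ?thesis .
qed

lemma periodic_conv: "periodic n g \<Longrightarrow> periodic n (conv n f g)"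
  by (simp add: periodic_def conv_def flip: diff_add_eq)

lemma conv_delta_left: "0 < n \<Longrightarrow> conv n (delta n) g x = g x"
proof -
  assume n_pos: "0 < n"
  have "conv n (delta n) g x = (\<Sum>y\<in>{0..<n}. if y = 0 then g x else 0)"
    unfolding conv_def by (rule sum.cong) (auto simp: delta_def zdvd_not_zless)
  then show ?thesis using n_pos by simp
qed

lemma conv_delta_right:
  assumes "0 < n" "periodic n f"
  shows "conv n f (delta n) x = f x"
  using sum_delta_periodic [OF assms] by (simp add: conv_def delta_minus_commute [of n x])

lemma conv_shift_left:
  assumes n_pos: "0 < n" and f_periodic: "periodic n f" and g_periodic: "periodic n g"
  shows "conv n (\<lambda>z. f (z - c)) g x = conv n f g (x - c)"
proof -
  have "conv n f g (x - c) = (\<Sum>y\<in>{0..<n}. f ((1 * y + c) - c) * g (x - (1 * y + c)))"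
    by (simp add: conv_def algebra_simps)
  also have "\<dots> = conv n (\<lambda>z. f (z - c)) g x"
    unfolding conv_def using n_pos f_periodic g_periodic
    by (intro sum_periodic_affine [where h = "\<lambda>y. f (y - c) * g (x - y)"]
        periodic_mult periodic_shift periodic_reflect) simp_all
  finally show ?thesis ..
qed

lemma convpow_scale: "convpow n (\<lambda>x. c * f x) k x = c ^ k * convpow n f k x"
  by (induction k arbitrary: x) (simp_all add: conv_def sum_distrib_left mult_ac)

lemma convpow_of_int: "convpow n (\<lambda>x. of_int (f x)) k x = of_int (convpow n f k x)"
  by (induction k arbitrary: x) (simp_all add: delta_def conv_def)

lemma convpow_idempotent:
  assumes "0 < n" "periodic n e" "conv n e e = e"
  shows "convpow n e (Suc k) = e"
  using assms by (induction k) (auto simp: conv_delta_right)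

section \<open>Polynomials modulo \<open>X ^ n - 1\<close>\<close>

text \<open>The class of a polynomial in the group ring of the integers modulo \<open>n\<close>, computed by
  Horner's scheme.\<close>

definition wrap :: "int \<Rightarrow> 'a poly \<Rightarrow> int \<Rightarrow> 'a :: comm_ring_1" where
  "wrap n P = fold_coeffs (\<lambda>a f z. a * delta n z + f (z - 1)) P (\<lambda>_. 0)"

lemma wrap_0: "wrap n 0 z = 0"
  by (simp add: wrap_def)

lemma wrap_pCons: "wrap n (pCons a P) z = a * delta n z + wrap n P (z - 1)"
  by (cases "a = 0 \<and> P = 0") (auto simp: wrap_def)

lemma periodic_wrap: "periodic n (wrap n P)"
proof (induction P)
  case (pCons a P)
  then show ?case
    using periodic_shift [of n "wrap n P" 1] by (simp add: periodic_def wrap_pCons delta_def)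
qed (simp add: periodic_def wrap_0)

lemma wrap_add: "wrap n (P + Q) z = wrap n P z + wrap n Q z"
  by (induction P Q arbitrary: z rule: poly_induct2) (simp_all add: wrap_0 wrap_pCons algebra_simps)

lemma wrap_smult: "wrap n (smult a P) z = a * wrap n P z"
  by (induction P arbitrary: z) (simp_all add: wrap_0 wrap_pCons algebra_simps)

lemma wrap_diff: "wrap n (P - Q) z = wrap n P z - wrap n Q z"
  using wrap_add [of n "P - Q" Q z] by simp

lemma wrap_sum: "wrap n (sum F A) z = (\<Sum>a\<in>A. wrap n (F a) z)"
  by (induction A rule: infinite_finite_induct) (simp_all add: wrap_0 wrap_add)

lemma wrap_monom: "wrap n (monom a k) z = a * delta n (z - int k)"
  by (induction k arbitrary: z) (simp_all add: monom_0 monom_Suc wrap_0 wrap_pCons algebra_simps)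

lemma wrap_mult: "0 < n \<Longrightarrow> wrap n (P * Q) z = conv n (wrap n P) (wrap n Q) z"
proof (induction P arbitrary: z)
  case 0
  then show ?case by (simp add: wrap_0 conv_def)
next
  case (pCons a P)
  have "wrap n (pCons a P * Q) z = a * wrap n Q z + conv n (wrap n P) (wrap n Q) (z - 1)"
    using pCons by (simp add: wrap_add wrap_smult wrap_pCons)
  also have "\<dots> = a * conv n (delta n) (wrap n Q) z + conv n (\<lambda>z. wrap n P (z - 1)) (wrap n Q) z"
    using pCons by (simp add: conv_delta_left conv_shift_left periodic_wrap)
  also have "\<dots> = conv n (wrap n (pCons a P)) (wrap n Q) z"
    by (simp add: conv_def wrap_pCons distrib_right sum.distrib sum_distrib_left mult.assoc)
  finally show ?case .
qed

lemma wrap_power: "0 < n \<Longrightarrow> wrap n (P ^ k) = convpow n (wrap n P) k"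
proof (induction k)
  case 0
  show ?case by (simp add: fun_eq_iff wrap_monom flip: monom_eq_1)
next
  case (Suc k)
  then show ?case by (intro ext) (simp add: wrap_mult)
qed

lemma wrap_surj:
  assumes n_pos: "0 < n" and f_periodic: "periodic n f"
  shows "wrap n (\<Sum>y\<in>{0..<n}. monom (f y) (nat y)) = f"
proof
  fix z
  have "wrap n (\<Sum>y\<in>{0..<n}. monom (f y) (nat y)) z = (\<Sum>y\<in>{0..<n}. f y * delta n (y - z))"
    unfolding wrap_sum by (rule sum.cong) (simp_all add: wrap_monom delta_minus_commute [of n z])
  then show "wrap n (\<Sum>y\<in>{0..<n}. monom (f y) (nat y)) z = f z"
    by (simp add: sum_delta_periodic [OF n_pos f_periodic])
qed

lemma prime_dvd_power_add_diff:
  fixes a b :: "'a :: comm_ring_1"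
  assumes p_prime: "prime p"
  shows "of_nat p dvd (a + b) ^ p - (a ^ p + b ^ p)"
proof -
  have p_pos: "0 < p" using p_prime by (simp add: prime_gt_0_nat)
  have "(a + b) ^ p = (\<Sum>k\<le>p. of_nat (p choose k) * a ^ k * b ^ (p - k))"
    by (rule binomial_ring)
  also have "{..p} = insert 0 (insert p {1..<p})" using p_pos by auto
  also have "(\<Sum>k\<in>insert 0 (insert p {1..<p}). of_nat (p choose k) * a ^ k * b ^ (p - k))
      = b ^ p + (a ^ p + (\<Sum>k\<in>{1..<p}. of_nat (p choose k) * a ^ k * b ^ (p - k)))"
    using p_pos by (subst sum.insert) auto
  finally have "(a + b) ^ p - (a ^ p + b ^ p)
      = (\<Sum>k\<in>{1..<p}. of_nat (p choose k) * a ^ k * b ^ (p - k))"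
    by (simp add: algebra_simps)
  also have "of_nat p dvd \<dots>"
  proof (rule dvd_sum)
    fix k assume "k \<in> {1..<p}"
    then have "p dvd p choose k" using p_prime by (intro dvd_choose_prime) auto
    then have "(of_nat p :: 'a) dvd of_nat (p choose k)" by (metis dvd_def of_nat_mult)
    then show "of_nat p dvd of_nat (p choose k) * a ^ k * b ^ (p - k)" by (simp add: mult.assoc)
  qed
  finally show ?thesis .
qed

lemma prime_dvd_power_sum_diff:
  fixes F :: "'b \<Rightarrow> 'a :: comm_ring_1"
  assumes p_prime: "prime p"
  shows "of_nat p dvd (sum F A) ^ p - (\<Sum>a\<in>A. F a ^ p)"
proof (induction A rule: infinite_finite_induct)
  case (insert a A)
  have "(sum F (insert a A)) ^ p - (\<Sum>a\<in>insert a A. F a ^ p)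
     = ((F a + sum F A) ^ p - (F a ^ p + sum F A ^ p)) + (sum F A ^ p - (\<Sum>a\<in>A. F a ^ p))"
    using insert by simp
  then show ?case using insert.IH prime_dvd_power_add_diff [OF p_prime, of "F a" "sum F A"]
    by (metis dvd_add)
qed (use p_prime in \<open>auto simp: power_0_left\<close>)

lemma prime_dvd_int_power_diff:
  assumes p_prime: "prime p"
  shows "int p dvd a ^ p - a"
proof -
  have of_nat: "int p dvd int k ^ p - int k" for k
    using prime_dvd_power_sum_diff [OF p_prime, of "\<lambda>_. 1 :: int" "{..<k}"] by simp
  have "0 < int p" using p_prime by (simp add: prime_gt_0_nat)
  then have "(a mod int p) ^ p mod int p = a mod int p"
    using of_nat [of "nat (a mod int p)"] by (simp flip: mod_eq_dvd_iff)
  then show ?thesis by (simp add: power_mod flip: mod_eq_dvd_iff)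
qed

text \<open>Frobenius in the group ring: this is the source of both Schur's theorem on prime powers
  and the invariance of rational idempotents under multiplication by units.\<close>

lemma convpow_prime_cong:
  fixes f :: "int \<Rightarrow> int"
  assumes n_pos: "0 < n" and f_periodic: "periodic n f" and p_prime: "prime p"
  shows "[convpow n f p z = (\<Sum>y\<in>{0..<n}. f y ^ p * delta n (int p * y - z))] (mod int p)"
proof -
  define P where "P = (\<Sum>y\<in>{0..<n}. monom (f y) (nat y))"
  have "of_nat p dvd P ^ p - (\<Sum>y\<in>{0..<n}. monom (f y) (nat y) ^ p)"
    unfolding P_def by (rule prime_dvd_power_sum_diff [OF p_prime])
  then obtain R where "P ^ p - (\<Sum>y\<in>{0..<n}. monom (f y) (nat y) ^ p) = of_nat p * R" by blast
  then have "P ^ p = (\<Sum>y\<in>{0..<n}. monom (f y ^ p) (nat y * p)) + smult (int p) R"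
    by (simp add: monom_power algebra_simps of_nat_poly)
  then have "wrap n (P ^ p) z
      = (\<Sum>y\<in>{0..<n}. f y ^ p * delta n (z - int (nat y * p))) + int p * wrap n R z"
    by (simp only: wrap_add wrap_sum wrap_monom wrap_smult)
  also have "(\<Sum>y\<in>{0..<n}. f y ^ p * delta n (z - int (nat y * p)))
      = (\<Sum>y\<in>{0..<n}. f y ^ p * delta n (int p * y - z))"
    by (rule sum.cong) (simp_all add: mult.commute delta_minus_commute [of n z])
  finally show ?thesis
    using n_pos f_periodic by (simp add: wrap_power wrap_surj P_def cong_def)
qed

section \<open>Integers modulo \<open>n\<close>\<close>

lemma gcd_eq_if_dvd_diff: "n dvd x - y \<Longrightarrow> gcd x n = gcd y n" for n x y :: int
  by (metis gcd.commute gcd_red_int mod_eq_dvd_iff)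

lemma exists_coprime_shift:
  fixes a m N :: int
  assumes a_coprime_m: "coprime a m" and N_nonzero: "N \<noteq> 0"
  shows "\<exists>t. coprime (a + m * t) N"
proof -
  define P where "P = {p \<in> prime_factors N. \<not> p dvd a}"
  have finite_P: "finite P" by (simp add: P_def)
  have "\<not> p dvd a + m * \<Prod>P" if p_prime: "prime p" and p_dvd_N: "p dvd N" for p
  proof (cases "p dvd a")
    case True
    then have "\<not> p dvd m"
      using p_prime p_dvd_N a_coprime_m by (meson coprime_common_divisor not_prime_unit)
    moreover have "\<not> p dvd q" if "q \<in> P" for q
      using that p_prime p_dvd_N True
      by (auto simp: P_def in_prime_factors_iff dest: primes_dvd_imp_eq)
    then have "\<not> p dvd \<Prod>P" using prime_dvd_prod_iff [OF finite_P p_prime, of "\<lambda>q. q"] by simp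
    ultimately show ?thesis
      using True p_prime by (simp add: dvd_add_right_iff prime_dvd_mult_iff)
  next
    case False
    then have "p \<in> P" using p_prime p_dvd_N N_nonzero by (simp add: P_def in_prime_factors_iff)
    then have "p dvd m * \<Prod>P" using dvd_prodI [OF finite_P, of p "\<lambda>q. q"] by simp
    then show ?thesis using False by (simp add: dvd_add_left_iff)
  qed
  moreover have "is_unit (gcd (a + m * \<Prod>P) N)"
    if "\<And>p. prime p \<Longrightarrow> \<not> p dvd gcd (a + m * \<Prod>P) N"
    using that N_nonzero prime_divisor_exists [of "gcd (a + m * \<Prod>P) N"] by auto
  ultimately have "coprime (a + m * \<Prod>P) N" by auto
  then show ?thesis ..
qed

lemma gcd_eq_imp_unit_multiple:
  fixes n N :: int
  assumes n_pos: "0 < n" and N_nonzero: "N \<noteq> 0" and gcd_eq: "gcd x n = gcd y n"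
  shows "\<exists>u. coprime u N \<and> n dvd y - u * x"
proof -
  obtain g where g_eq_gcd_x: "g = gcd x n" and g_eq_gcd_y: "g = gcd y n" and g_nonzero: "g \<noteq> 0"
    using n_pos gcd_eq by simp
  obtain x' n' where x_eq: "x = x' * g" and n_eq: "n = n' * g" and coprime_x'_n': "coprime x' n'"
    using gcd_coprime_exists [of x n] g_eq_gcd_x g_eq_gcd_y g_nonzero by blast
  obtain y' n'' where y_eq: "y = y' * g" and n_eq': "n = n'' * g"
    and coprime_y'_n'': "coprime y' n''"
    using gcd_coprime_exists [of y n] g_eq_gcd_x g_eq_gcd_y g_nonzero by metis
  have "n'' = n'" using n_eq n_eq' g_nonzero by simp
  obtain w where w_inverse: "[x' * w = 1] (mod n')"
    using cong_solve_coprime_int coprime_x'_n' by blast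
  then have "coprime w n'" by (metis coprime_iff_invertible_int mult.commute)
  then have "coprime (y' * w) n'" using coprime_y'_n'' \<open>n'' = n'\<close> by simp
  then obtain t where t_coprime: "coprime (y' * w + n' * t) N"
    using exists_coprime_shift N_nonzero by blast
  have "[(y' * w + n' * t) * x' = y' * (x' * w)] (mod n')"
    by (simp add: cong_iff_dvd_diff algebra_simps)
  also have "[y' * (x' * w) = y' * 1] (mod n')" using w_inverse by (rule cong_scalar_left)
  finally have "n' dvd y' - (y' * w + n' * t) * x'"
    by (simp add: cong_iff_dvd_diff dvd_diff_commute)
  then have "n' * g dvd (y' - (y' * w + n' * t) * x') * g" by simp
  then have "n dvd y - (y' * w + n' * t) * x"
    by (simp add: x_eq n_eq y_eq left_diff_distrib mult.assoc)
  then show ?thesis using t_coprime by blast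
qed

lemma int_subgroup_eq_multiples:
  fixes n :: int
  assumes n_pos: "0 < n" and n_mem: "n \<in> H" and diff_mem: "\<And>a b. a \<in> H \<Longrightarrow> b \<in> H \<Longrightarrow> a - b \<in> H"
  obtains l where "0 < l" "H = {a. l dvd a}"
proof -
  define k where "k = (LEAST k. 0 < k \<and> int k \<in> H)"
  have k_pos: "0 < k" and k_mem: "int k \<in> H"
    using LeastI [of "\<lambda>k. 0 < k \<and> int k \<in> H" "nat n"] n_pos n_mem by (auto simp: k_def)
  have k_least: "k \<le> j" if "0 < j" "int j \<in> H" for j
    using that by (auto simp: k_def intro: Least_le)
  have zero_mem: "0 \<in> H" using diff_mem [OF n_mem n_mem] by simp
  have uminus_mem: "- a \<in> H" if "a \<in> H" for a using diff_mem [OF zero_mem that] by simp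
  have of_nat: "int k * int j \<in> H" for j
  proof (induction j)
    case (Suc j)
    then show ?case using diff_mem [OF Suc uminus_mem [OF k_mem]] by (simp add: algebra_simps)
  qed (simp add: zero_mem)
  have multiple: "int k * j \<in> H" for j
    using of_nat [of "nat j"] uminus_mem [OF of_nat [of "nat (- j)"]] by (cases "0 \<le> j") auto
  have "int k dvd a" if a_mem: "a \<in> H" for a
  proof (rule ccontr)
    assume "\<not> int k dvd a"
    then have "a mod int k \<noteq> 0" by (simp add: dvd_eq_mod_eq_0)
    moreover have "0 \<le> a mod int k" "a mod int k < int k" using k_pos by simp_all
    ultimately have "0 < a mod int k" "a mod int k < int k" by simp_all
    moreover have "a - int k * (a div int k) \<in> H" using diff_mem [OF a_mem multiple] .
    then have "a mod int k \<in> H" by (simp add: minus_mult_div_eq_mod)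
    ultimately show False using k_least [of "nat (a mod int k)"] by simp
  qed
  then have "H = {a. int k dvd a}" using multiple by auto
  then show thesis using that k_pos by (metis of_nat_0_less_iff)
qed

lemma prime_power_part:
  fixes q n :: int
  assumes q_prime: "prime q" and n_nonzero: "n \<noteq> 0" and q_dvd_n: "q dvd n"
  obtains e m where "n = q ^ Suc e * m" "coprime q m"
proof -
  have "\<not> is_unit q" using q_prime not_prime_unit by blast
  then obtain m where n_eq: "n = q ^ multiplicity q n * m" and not_q_dvd_m: "\<not> q dvd m"
    using multiplicity_decompose' [of n q] n_nonzero q_dvd_n by auto
  obtain e where "multiplicity q n = Suc e"
    using n_nonzero q_dvd_n \<open>\<not> is_unit q\<close> not0_implies_Suc multiplicity_eq_zero_iff by metis
  moreover have "coprime q m" using n_eq not_q_dvd_m q_prime by (simp add: prime_imp_coprime)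
  ultimately show thesis using that n_eq not_q_dvd_m by metis
qed

lemma gcd_minus_lcm: "gcd (a - b) (lcm a b) = gcd a b" for a b :: int
proof (cases "gcd a b = 0")
  case False
  define g where "g = gcd a b"
  obtain a' b' where a_eq: "a = a' * g" and b_eq: "b = b' * g" and coprime_a'_b': "coprime a' b'"
    unfolding g_def using gcd_coprime_exists [OF False] by blast
  have g_pos: "0 < g" using False by (simp add: g_def order_less_le)
  have "coprime (a' - b') a'" "coprime (a' - b') b'"
    using coprime_a'_b' gcd_diff1 [of a' b'] gcd_diff2 [of a' b']
    by (simp_all add: coprime_iff_gcd_eq_1 gcd.commute)
  then have "coprime (a' - b') (a' * b')" by simp
  then have "gcd (a' - b') \<bar>a' * b'\<bar> = 1" by (simp only: gcd_abs2_int coprime_iff_gcd_eq_1)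
  moreover have "a - b = (a' - b') * g" by (simp add: a_eq b_eq left_diff_distrib)
  moreover have "lcm a b = \<bar>a' * b'\<bar> * g"
    using g_pos lcm_coprime [OF coprime_a'_b']
    by (simp add: a_eq b_eq lcm_mult_right lcm.commute [of b'])
  ultimately show ?thesis using g_pos by (simp add: gcd_mult_right gcd.commute flip: g_def)
qed simp

lemma gcd_minus_eq_gcd:
  fixes a b n :: int
  assumes "gcd a b dvd n" and "n dvd lcm a b"
  shows "gcd (a - b) n = gcd a b"
proof (rule zdvd_antisym_nonneg)
  have "gcd (a - b) n dvd gcd (a - b) (lcm a b)"
    using assms(2) by (meson dvd_trans gcd_dvd1 gcd_dvd2 gcd_greatest)
  then show "gcd (a - b) n dvd gcd a b" by (simp only: gcd_minus_lcm)
  show "gcd a b dvd gcd (a - b) n" using assms(1) by simp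
qed simp_all

section \<open>Rational S-rings\<close>

definition gcd_invariant :: "int \<Rightarrow> (int \<Rightarrow> 'a) \<Rightarrow> bool" where
  "gcd_invariant n f \<longleftrightarrow> (\<forall>x y. gcd x n = gcd y n \<longrightarrow> f x = f y)"

lemma gcd_invariantD: "gcd_invariant n f \<Longrightarrow> gcd x n = gcd y n \<Longrightarrow> f x = f y"
  unfolding gcd_invariant_def by blast

lemma gcd_invariant_minus: "gcd_invariant n f \<Longrightarrow> f (- x) = f x"
  by (erule gcd_invariantD) simp

lemma gcd_invariant_mult_unit: "gcd_invariant n f \<Longrightarrow> coprime u n \<Longrightarrow> f (u * x) = f x"
  by (erule gcd_invariantD) (simp add: gcd_mult_left_left_cancel coprime_commute)

lemma periodic_if_gcd_invariant: "gcd_invariant n f \<Longrightarrow> periodic n f"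
  unfolding periodic_def by (auto elim!: gcd_invariantD)

lemma gcd_invariant_delta: "m dvd n \<Longrightarrow> gcd_invariant n (delta m)"
  unfolding gcd_invariant_def delta_def
  by (intro allI impI arg_cong [where f = of_bool]) (metis dvd_gcdD1 gcd_greatest)

lemma gcd_invariantI:
  assumes n_pos: "0 < n" and f_periodic: "periodic n f"
    and unit: "\<And>u x. coprime u n \<Longrightarrow> f (u * x) = f x"
  shows "gcd_invariant n f"
  unfolding gcd_invariant_def
proof (intro allI impI)
  fix x y assume "gcd x n = gcd y n"
  then obtain u where u_coprime: "coprime u n" and n_dvd_diff: "n dvd y - u * x"
    using gcd_eq_imp_unit_multiple [OF n_pos, of n] n_pos by auto
  have "f y = f (u * x)" by (rule periodicD [OF f_periodic n_dvd_diff])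
  also have "\<dots> = f x" by (rule unit [OF u_coprime])
  finally show "f x = f y" ..
qed

locale rational_sring =
  fixes n :: int and C :: "(int \<Rightarrow> rat) set"
  assumes n_pos: "0 < n"
    and gcd_invariant: "\<And>f. f \<in> C \<Longrightarrow> gcd_invariant n f"
    and const_mem: "\<And>a. (\<lambda>_. a) \<in> C"
    and delta_mem: "delta n \<in> C"
    and add_mem: "\<And>f g. f \<in> C \<Longrightarrow> g \<in> C \<Longrightarrow> (\<lambda>x. f x + g x) \<in> C"
    and mult_mem: "\<And>f g. f \<in> C \<Longrightarrow> g \<in> C \<Longrightarrow> (\<lambda>x. f x * g x) \<in> C"
    and conv_mem: "\<And>f g. f \<in> C \<Longrightarrow> g \<in> C \<Longrightarrow> conv n f g \<in> C"
begin

text \<open>An S-divisor is a divisor of \<open>n\<close> that generates an S-subgroup, and \<open>S_hull x\<close> generates the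
  smallest S-subgroup containing \<open>x\<close>.\<close>

definition indist :: "int \<Rightarrow> int \<Rightarrow> bool" where
  "indist x y \<longleftrightarrow> (\<forall>f\<in>C. f x = f y)"

definition basic_set :: "int \<Rightarrow> int set" where
  "basic_set x = {y. indist x y}"

definition S_set :: "int set \<Rightarrow> bool" where
  "S_set A \<longleftrightarrow> (\<lambda>x. of_bool (x \<in> A)) \<in> C"

definition S_divisor :: "int \<Rightarrow> bool" where
  "S_divisor h \<longleftrightarrow> 0 < h \<and> h dvd n \<and> S_set {x. h dvd x}"

definition S_hull :: "int \<Rightarrow> int" where
  "S_hull x = Lcm {h. S_divisor h \<and> h dvd x}"

lemma indist_refl: "indist x x"
  by (simp add: indist_def)

lemma indist_sym: "indist x y \<Longrightarrow> indist y x"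
  by (auto simp: indist_def)

lemma indist_trans: "indist x y \<Longrightarrow> indist y z \<Longrightarrow> indist x z"
  by (auto simp: indist_def)

lemma indist_if_gcd_eq: "gcd x n = gcd y n \<Longrightarrow> indist x y"
  using gcd_invariant by (auto simp: indist_def gcd_invariant_def)

lemma indist_if_dvd_diff: "n dvd x - y \<Longrightarrow> indist x y"
  by (rule indist_if_gcd_eq [OF gcd_eq_if_dvd_diff])

lemma indist_minus: "indist x (- x)"
  by (rule indist_if_gcd_eq) simp

lemma indist_mod: "indist x (x mod n)"
  by (rule indist_if_dvd_diff) (simp add: minus_mod_eq_mult_div)

lemma sum_mem: "(\<And>a. a \<in> A \<Longrightarrow> F a \<in> C) \<Longrightarrow> (\<lambda>x. \<Sum>a\<in>A. F a x) \<in> C"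
  by (induction A rule: infinite_finite_induct) (auto intro: const_mem add_mem)

lemma prod_mem: "(\<And>a. a \<in> A \<Longrightarrow> F a \<in> C) \<Longrightarrow> (\<lambda>x. \<Prod>a\<in>A. F a x) \<in> C"
  by (induction A rule: infinite_finite_induct) (auto intro: const_mem mult_mem)

lemma convpow_mem: "f \<in> C \<Longrightarrow> convpow n f k \<in> C"
  by (induction k) (auto intro: delta_mem conv_mem)

lemma S_set_basic_set: "S_set (basic_set x)"
proof -
  define B where "B = {y \<in> {0..<n}. \<not> indist x y}"
  have "\<exists>f\<in>C. f x \<noteq> f y" if "y \<in> B" for y using that by (auto simp: B_def indist_def)
  then obtain F where F_separates: "\<And>y. y \<in> B \<Longrightarrow> F y \<in> C \<and> F y x \<noteq> F y y" by metis
  define L where "L z = (\<Prod>y\<in>B. (F y z + - F y y) * inverse (F y x - F y y))" for z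
  have "L z = of_bool (indist x z)" for z
  proof (cases "indist x z")
    case True
    then have "F y z = F y x" if "y \<in> B" for y
      using F_separates [OF that] by (auto simp: indist_def)
    then show ?thesis using True F_separates by (auto simp: L_def intro!: prod.neutral)
  next
    case False
    then have "\<not> indist x (z mod n)" using indist_mod indist_trans indist_sym by blast
    then have "z mod n \<in> B" using n_pos by (simp add: B_def)
    moreover have "F (z mod n) z = F (z mod n) (z mod n)"
      using F_separates [OF \<open>z mod n \<in> B\<close>] indist_mod [of z] by (simp add: indist_def)
    moreover have "finite B" unfolding B_def by (rule finite_subset [of _ "{0..<n}"]) auto
    ultimately show ?thesis
      using False by (auto simp: L_def intro!: prod_zero bexI [of _ "z mod n"])
  qed
  then have "(\<lambda>z. of_bool (z \<in> basic_set x)) = L" by (auto simp: basic_set_def)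
  also have "L \<in> C"
    unfolding L_def [abs_def] using F_separates by (intro prod_mem mult_mem add_mem const_mem) auto
  finally show ?thesis by (simp add: S_set_def)
qed

lemma mem_iff: "f \<in> C \<longleftrightarrow> (\<forall>x y. indist x y \<longrightarrow> f x = f y)"
proof
  assume f_respects_indist: "\<forall>x y. indist x y \<longrightarrow> f x = f y"
  define N where "N x = rat_of_nat (card {y \<in> {0..<n}. indist x y})" for x
  have N_nonzero: "N x \<noteq> 0" for x
  proof -
    have "x mod n \<in> {y \<in> {0..<n}. indist x y}" using n_pos indist_mod by simp
    moreover have "finite {y \<in> {0..<n}. indist x y}" by (rule finite_subset [of _ "{0..<n}"]) auto
    ultimately show ?thesis using card_gt_0_iff by (auto simp: N_def)
  qed
  have "f z = (\<Sum>x\<in>{0..<n}. f x * inverse (N x) * of_bool (indist x z))" for z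
  proof -
    have "f x * inverse (N x) * of_bool (indist x z) = f z * inverse (N z) * of_bool (indist z x)"
      for x
    proof (cases "indist x z")
      case True
      then have "{y \<in> {0..<n}. indist x y} = {y \<in> {0..<n}. indist z y}"
        using indist_sym indist_trans by blast
      then show ?thesis using f_respects_indist True indist_sym by (simp add: N_def)
    qed (use indist_sym in auto)
    then have "(\<Sum>x\<in>{0..<n}. f x * inverse (N x) * of_bool (indist x z))
        = f z * inverse (N z) * (\<Sum>x\<in>{0..<n}. of_bool (indist z x))"
      by (simp only: sum_distrib_left)
    also have "(\<Sum>x\<in>{0..<n}. of_bool (indist z x)) = N z"
      by (simp add: N_def Int_def)
    finally show ?thesis using N_nonzero by simp
  qed
  then have "f = (\<lambda>z. \<Sum>x\<in>{0..<n}. f x * inverse (N x) * of_bool (indist x z))" ..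
  also have "\<dots> \<in> C"
    using S_set_basic_set by (intro sum_mem mult_mem const_mem) (simp add: S_set_def basic_set_def)
  finally show "f \<in> C" .
qed (simp add: indist_def)

lemma S_set_iff: "S_set A \<longleftrightarrow> (\<forall>x y. indist x y \<longrightarrow> (x \<in> A \<longleftrightarrow> y \<in> A))"
  by (auto simp: S_set_def mem_iff)

lemma S_setD: "S_set A \<Longrightarrow> indist x y \<Longrightarrow> x \<in> A \<longleftrightarrow> y \<in> A"
  by (simp add: S_set_iff)

lemma S_set_periodic: "S_set A \<Longrightarrow> periodic n (\<lambda>x. of_bool (x \<in> A))"
  using S_setD [OF _ indist_if_dvd_diff, of A "x + n" x for x] by (simp add: periodic_def)

lemma S_divisor_dvd_iff: "S_divisor h \<Longrightarrow> indist x y \<Longrightarrow> h dvd x \<longleftrightarrow> h dvd y"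
  using S_setD [of "{x. h dvd x}"] by (simp add: S_divisor_def)

lemma S_set_plus:
  assumes S_set_A: "S_set A" and S_set_B: "S_set B"
  shows "S_set {x. \<exists>y\<in>A. x - y \<in> B}"
proof -
  define f :: "int \<Rightarrow> rat" where "f = conv n (\<lambda>x. of_bool (x \<in> A)) (\<lambda>x. of_bool (x \<in> B))"
  have "(\<exists>y\<in>A. x - y \<in> B) \<longleftrightarrow> f x \<noteq> 0" for x
  proof -
    have "f x \<noteq> 0 \<longleftrightarrow> (\<exists>y\<in>{0..<n}. y \<in> A \<and> x - y \<in> B)"
      by (auto simp: f_def conv_def sum_nonneg_eq_0_iff)
    moreover have "y mod n \<in> A \<and> x - y mod n \<in> B" if "y \<in> A" "x - y \<in> B" for y
    proof -
      have "n dvd (x - y) - (x - y mod n)"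
        by (simp add: mod_eq_dvd_iff [symmetric] mod_diff_right_eq)
      then show ?thesis using that S_setD [OF S_set_A indist_mod] S_setD [OF S_set_B
          indist_if_dvd_diff] by blast
    qed
    moreover have "y mod n \<in> {0..<n}" for y using n_pos by simp
    ultimately show ?thesis by blast
  qed
  moreover have "f \<in> C"
    using S_set_A S_set_B unfolding f_def by (intro conv_mem) (simp_all add: S_set_def)
  ultimately show ?thesis by (auto simp: S_set_iff indist_def)
qed

lemma S_divisor_1: "S_divisor 1"
  using const_mem [of 1] by (simp add: S_divisor_def S_set_def)

lemma S_divisor_modulus: "S_divisor n"
  using delta_mem n_pos by (simp add: S_divisor_def S_set_def delta_def [abs_def])

lemma S_divisor_le: "S_divisor h \<Longrightarrow> h \<le> n"
  using n_pos by (auto simp: S_divisor_def intro: zdvd_imp_le)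

lemma S_divisor_lcm: "S_divisor g \<Longrightarrow> S_divisor h \<Longrightarrow> S_divisor (lcm g h)"
  unfolding S_divisor_def S_set_iff by (auto simp: lcm_pos_int)

lemma S_divisor_gcd:
  assumes "S_divisor g" and "S_divisor h"
  shows "S_divisor (gcd g h)"
proof -
  have "(\<exists>y. g dvd y \<and> h dvd x - y) \<longleftrightarrow> gcd g h dvd x" for x
  proof
    assume "\<exists>y. g dvd y \<and> h dvd x - y"
    then show "gcd g h dvd x" by (metis diff_add_cancel dvd_add dvd_trans gcd_dvd1 gcd_dvd2)
  next
    assume "gcd g h dvd x"
    then obtain k where "x = gcd g h * k" by blast
    moreover obtain u v where "u * g + v * h = gcd g h" using bezout_int by blast
    ultimately have "x = (u * g + v * h) * k" by simp
    then have "x - g * (u * k) = h * (v * k)" by (simp add: algebra_simps)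
    then show "\<exists>y. g dvd y \<and> h dvd x - y" by (metis dvd_triv_left)
  qed
  moreover have "gcd g h dvd n" using assms(1) by (meson S_divisor_def dvd_trans gcd_dvd1)
  ultimately show ?thesis
    using assms S_set_plus [of "{x. g dvd x}" "{x. h dvd x}"] by (simp add: S_divisor_def Bex_def)
qed

lemma S_divisor_S_hull: "S_divisor (S_hull x)"
proof -
  have "finite {h. S_divisor h \<and> h dvd x}"
    by (rule finite_subset [of _ "{0..n}"]) (auto simp: S_divisor_le S_divisor_def less_imp_le)
  moreover have "finite A \<Longrightarrow> (\<forall>h\<in>A. S_divisor h) \<Longrightarrow> S_divisor (Lcm A)" for A :: "int set"
    by (induction A rule: finite_induct) (auto intro: S_divisor_1 S_divisor_lcm)
  ultimately show ?thesis unfolding S_hull_def by blast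
qed

lemma S_hull_dvd: "S_hull x dvd x"
  unfolding S_hull_def by (rule Lcm_least) simp

lemma dvd_S_hull: "S_divisor g \<Longrightarrow> g dvd x \<Longrightarrow> g dvd S_hull x"
  unfolding S_hull_def by (rule dvd_Lcm) simp

lemma S_hull_cong: "indist x y \<Longrightarrow> S_hull x = S_hull y"
  using S_divisor_dvd_iff [of _ x y] by (auto simp: S_hull_def intro!: arg_cong [where f = Lcm])

lemma ex_stabilizer:
  assumes S_set_X: "S_set X"
  obtains l where "S_divisor l" "\<And>a. l dvd a \<longleftrightarrow> (\<forall>x\<in>X. x - a \<in> X)"
proof -
  define H where "H = {a. \<forall>x\<in>X. x - a \<in> X}"
  have "a - x \<in> X \<longleftrightarrow> x - a \<in> X" for a x
    using S_setD [OF S_set_X indist_minus, of "a - x"] by simp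
  then have "- H = {a. \<exists>x\<in>X. a - x \<in> - X}" by (auto simp: H_def)
  moreover have "S_set (- X)" using S_set_X by (simp add: S_set_iff)
  ultimately have "S_set (- H)" by (simp only: S_set_plus [OF S_set_X])
  then have S_set_H: "S_set H" by (simp add: S_set_iff)
  have modulus_mem: "n \<in> H"
    using S_setD [OF S_set_X indist_if_dvd_diff, of "x - n" x for x] by (auto simp: H_def)
  have "a - b \<in> H" if "a \<in> H" "b \<in> H" for a b
  proof -
    have "- b \<in> H" using that(2) S_setD [OF S_set_H indist_minus] by blast
    then have "x - - b - a \<in> X" if "x \<in> X" for x
      using \<open>a \<in> H\<close> that unfolding H_def by blast
    then have "x - (a - b) \<in> X" if "x \<in> X" for x
      using that by (simp add: diff_diff_eq2 diff_add_eq)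
    then show ?thesis by (simp add: H_def)
  qed
  then obtain l where "0 < l" "H = {a. l dvd a}"
    using int_subgroup_eq_multiples [OF n_pos modulus_mem] by metis
  then have "S_divisor l" using S_set_H modulus_mem by (simp add: S_divisor_def)
  then show thesis using that \<open>H = {a. l dvd a}\<close> unfolding H_def by blast
qed

lemma ex_largest_S_subgroup:
  assumes m_dvd_n: "m dvd n"
  obtains k where "S_divisor k" "m dvd k" "\<And>A. S_set A \<Longrightarrow> A \<subseteq> {x. m dvd x} \<Longrightarrow> A \<subseteq> {x. k dvd x}"
proof -
  define Y where "Y = {x. \<forall>y. indist x y \<longrightarrow> m dvd y}"
  have S_set_Y: "S_set Y" using indist_sym indist_trans unfolding S_set_iff Y_def by blast
  have modulus_mem: "n \<in> Y"
    using m_dvd_n S_divisor_dvd_iff [OF S_divisor_modulus, of n] dvd_trans by (auto simp: Y_def)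
  have "a - b \<in> Y" if "a \<in> Y" "b \<in> Y" for a b
  proof -
    let ?A = "{x. \<exists>y\<in>basic_set a. x - y \<in> basic_set b}"
    have S_set_A: "S_set ?A" by (rule S_set_plus [OF S_set_basic_set S_set_basic_set])
    have "m dvd x" if "x \<in> ?A" for x
      using that \<open>a \<in> Y\<close> \<open>b \<in> Y\<close> by (auto simp: Y_def basic_set_def) (metis diff_add_cancel dvd_add)
    moreover have "a - b \<in> ?A"
      using indist_refl [of a] indist_minus [of b] by (auto simp: basic_set_def)
    ultimately show ?thesis using S_setD [OF S_set_A] unfolding Y_def by blast
  qed
  then obtain k where k_pos: "0 < k" and Y_eq: "Y = {x. k dvd x}"
    using int_subgroup_eq_multiples [OF n_pos modulus_mem] by metis
  show thesis
  proof
    show "S_divisor k" using S_set_Y modulus_mem k_pos Y_eq by (simp add: S_divisor_def)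
    have "k \<in> Y" by (simp add: k_pos Y_eq)
    then show "m dvd k" using indist_refl by (auto simp: Y_def)
    show "A \<subseteq> {x. k dvd x}" if "S_set A" "A \<subseteq> {x. m dvd x}" for A
      using that S_setD [of A] by (auto simp: Y_def simp flip: Y_eq)
  qed
qed

lemma quotient:
  assumes S_divisor_m: "S_divisor m"
  shows "rational_sring m {f \<in> C. periodic m f}"
proof
  have m_pos: "0 < m" and m_dvd_n: "m dvd n" using S_divisor_m by (auto simp: S_divisor_def)
  show "0 < m" by (rule m_pos)
  show "delta m \<in> {f \<in> C. periodic m f}"
    using S_divisor_m periodic_delta [of m]
    by (simp add: S_divisor_def S_set_def delta_def [abs_def])
  show "gcd_invariant m f" if "f \<in> {f \<in> C. periodic m f}" for f
    unfolding gcd_invariant_def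
  proof (intro allI impI)
    fix x y assume "gcd x m = gcd y m"
    then obtain u where u_coprime: "coprime u n" and m_dvd_diff: "m dvd y - u * x"
      using gcd_eq_imp_unit_multiple [OF m_pos, of n] n_pos by auto
    have "f y = f (u * x)" using that m_dvd_diff by (auto elim: periodicD)
    then show "f x = f y"
      using that gcd_invariant_mult_unit [OF gcd_invariant u_coprime, of f x] by simp
  qed
  fix f g assume f_mem: "f \<in> {f \<in> C. periodic m f}" and g_mem: "g \<in> {f \<in> C. periodic m f}"
  have "n div m \<noteq> 0" using m_pos m_dvd_n n_pos by (auto simp: dvd_div_eq_0_iff)
  then have "conv m f g x = inverse (of_int (n div m)) * conv n f g x" for x
    using f_mem g_mem m_pos m_dvd_n n_pos sum_periodic_dvd [of m n "\<lambda>y. f y * g (x - y)"]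
    by (simp add: conv_def periodic_mult periodic_reflect)
  then have "conv m f g = (\<lambda>x. inverse (of_int (n div m)) * conv n f g x)" ..
  moreover have "(\<lambda>x. inverse (of_int (n div m)) * conv n f g x) \<in> C"
    using f_mem g_mem by (intro mult_mem const_mem conv_mem) auto
  ultimately show "conv m f g \<in> {f \<in> C. periodic m f}" using g_mem periodic_conv [of m g f] by simp
qed (auto simp: periodic_def intro: const_mem add_mem mult_mem)

end

section \<open>Schur's theorem on prime powers\<close>

lemma sum_delta_multiple:
  fixes h :: "int \<Rightarrow> 'a :: comm_ring_1"
  assumes q_pos: "0 < q" and M_pos: "0 < M" and h_periodic: "periodic (q * M) h"
  shows "(\<Sum>y\<in>{0..<q * M}. h y * delta M (y - c)) = (\<Sum>j\<in>{0..<q}. h (c + j * M))"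
proof -
  have "periodic (q * M) (\<lambda>y. h y * delta M (y - c))"
    by (intro periodic_mult h_periodic periodic_shift periodic_dvd [OF periodic_delta]) simp
  then have "(\<Sum>y\<in>{0..<q * M}. h y * delta M (y - c)) = (\<Sum>y\<in>{0..<q * M}. h (y + c) * delta M y)"
    using sum_periodic_affine [of "q * M" "\<lambda>y. h y * delta M (y - c)" 1 c] q_pos M_pos by simp
  also have "\<dots> = (\<Sum>y\<in>(\<lambda>j. j * M) ` {0..<q}. h (y + c) * delta M y)"
  proof (rule sum.mono_neutral_right)
    show "(\<lambda>j. j * M) ` {0..<q} \<subseteq> {0..<q * M}" using M_pos by auto
    have "y \<in> (\<lambda>j. j * M) ` {0..<q}" if "y \<in> {0..<q * M}" "M dvd y" for y
    proof -
      obtain j where "y = j * M" using \<open>M dvd y\<close> by (metis dvdE mult.commute)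
      then show ?thesis using that M_pos by (auto simp: zero_le_mult_iff)
    qed
    then show "\<forall>y\<in>{0..<q * M} - (\<lambda>j. j * M) ` {0..<q}. h (y + c) * delta M y = 0"
      by (auto simp: delta_def)
  qed simp
  also have "\<dots> = (\<Sum>j\<in>{0..<q}. h (c + j * M))"
    using M_pos by (subst sum.reindex) (auto simp: inj_on_def delta_def add.commute)
  finally show ?thesis .
qed

locale rational_sring_prime = rational_sring +
  fixes q m :: int and e :: nat
  assumes prime: "prime q" and coprime: "coprime q m" and modulus: "n = q ^ Suc e * m"
begin

definition Q :: int where "Q = q ^ Suc e"

definition M :: int where "M = q ^ e * m"

text \<open>For an S-set \<open>T\<close> these are the elements \<open>q x\<close> such that \<open>q\<close> does not divide the number of
  elements of \<open>T\<close> in the coset of \<open>x\<close> modulo \<open>M\<close>.\<close>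

definition jump :: "int set \<Rightarrow> int set" where
  "jump T = {z. Q dvd z \<and> (z \<in> T) \<noteq> (z + M \<in> T)}"

lemma prime_gt_1: "1 < q"
  using prime by (rule prime_gt_1_int)

lemma not_prime_dvd_1: "\<not> q dvd 1" "\<not> q dvd - 1"
  using prime not_prime_unit by auto

lemma n_eq: "n = q * M"
  by (simp add: modulus M_def)

lemma Q_dvd_n: "Q dvd n"
  by (simp add: modulus Q_def)

lemma M_pos: "0 < M"
  using n_pos prime_gt_1 by (simp add: n_eq zero_less_mult_iff)

lemma M_less: "M < n"
  using M_pos prime_gt_1 by (simp add: n_eq)

lemma Q_dvd_add_mult_M_iff:
  assumes "Q dvd z"
  shows "Q dvd z + j * M \<longleftrightarrow> q dvd j"
proof -
  have "Q dvd z + j * M \<longleftrightarrow> q ^ e * q dvd q ^ e * (j * m)"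
    using assms by (simp add: dvd_add_right_iff Q_def M_def mult_ac)
  also have "\<dots> \<longleftrightarrow> q dvd j" using prime_gt_1 coprime by (simp add: coprime_dvd_mult_left_iff)
  finally show ?thesis .
qed

lemma gcd_M:
  assumes "\<not> Q dvd x"
  shows "gcd x n = gcd x M"
proof (rule zdvd_antisym_nonneg)
  obtain c where n_eq_mult: "n = gcd x n * c" using gcd_dvd2 by blast
  have "q dvd c"
  proof (rule ccontr)
    assume "\<not> q dvd c"
    then have "coprime Q c" using prime by (simp add: Q_def prime_imp_coprime del: power_Suc)
    moreover have "Q dvd gcd x n * c" using Q_dvd_n n_eq_mult by simp
    ultimately have "Q dvd gcd x n" by (simp add: coprime_dvd_mult_left_iff)
    then show False using assms by simp
  qed
  then obtain d where "q * M = q * (gcd x n * d)"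
    using n_eq_mult n_eq by (metis dvdE mult.left_commute)
  then have "gcd x n dvd M" using prime_gt_1 by simp
  then show "gcd x n dvd gcd x M" by simp
  show "gcd x M dvd gcd x n" by (simp add: n_eq)
qed simp_all

lemma indist_if_not_Q_dvd:
  assumes "\<not> Q dvd x" "\<not> Q dvd y" "M dvd x - y"
  shows "indist x y"
  using gcd_eq_if_dvd_diff [OF assms(3)] assms by (intro indist_if_gcd_eq) (simp add: gcd_M)

lemma add_mult_M_mem_iff:
  assumes S_set_T: "S_set T" and Q_dvd_z: "Q dvd z"
  shows "z + j * M \<in> T \<longleftrightarrow> (if q dvd j then z \<in> T else z + M \<in> T)"
proof (cases "q dvd j")
  case True
  then have "indist (z + j * M) z" by (intro indist_if_dvd_diff) (simp add: n_eq)
  then show ?thesis using True S_setD [OF S_set_T] by simp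
next
  case False
  then have "indist (z + j * M) (z + M)"
    using Q_dvd_add_mult_M_iff [OF Q_dvd_z, of j] Q_dvd_add_mult_M_iff [OF Q_dvd_z, of 1]
      not_prime_dvd_1
    by (intro indist_if_not_Q_dvd) (auto simp: dvd_diff_commute)
  then show ?thesis using False S_setD [OF S_set_T] by simp
qed

lemma jump_cases:
  assumes S_set_T: "S_set T" and y_jumps: "(y \<in> T) \<noteq> (y + M \<in> T)"
  shows "y \<in> jump T \<or> y + M \<in> jump T"
proof (cases "Q dvd y")
  case False
  have "Q dvd y + M"
  proof (rule ccontr)
    assume "\<not> Q dvd y + M"
    then have "indist y (y + M)" using False by (intro indist_if_not_Q_dvd) simp_all
    then show False using y_jumps S_setD [OF S_set_T] by blast
  qed
  then have "(y + M) + (- 1) * M \<in> T \<longleftrightarrow> (y + M) + M \<in> T"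
    using add_mult_M_mem_iff [OF S_set_T, of "y + M" "- 1"] not_prime_dvd_1 by simp
  then show ?thesis using y_jumps \<open>Q dvd y + M\<close> by (auto simp: jump_def)
qed (use y_jumps in \<open>simp add: jump_def\<close>)

lemma minus_M_mem_Un_jump:
  assumes S_set_T: "S_set T" and jump_disjoint: "T \<inter> jump T = {}" and x_mem: "x \<in> T \<union> jump T"
  shows "x - M \<in> T \<union> jump T"
proof (cases "x \<in> T")
  case True
  then show ?thesis using jump_cases [OF S_set_T, of "x - M"] jump_disjoint by auto
next
  case False
  then have "Q dvd x" "x + M \<in> T" using x_mem by (auto simp: jump_def)
  then have "x + (- 1) * M \<in> T"
    using add_mult_M_mem_iff [OF S_set_T, of x "- 1"] not_prime_dvd_1 by simp
  then show ?thesis by simp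
qed

lemma indist_mult_prime:
  assumes Q_dvd_z: "Q dvd z"
  shows "indist (q * z) z" and "indist (q * z + M) (z + M)"
proof -
  obtain w where "z = Q * w" using Q_dvd_z by blast
  then have "gcd (q * z) n = \<bar>Q\<bar> * gcd (q * w) m" "gcd z n = \<bar>Q\<bar> * gcd w m"
    unfolding gcd_mult_distrib_int by (simp_all add: modulus Q_def mult_ac)
  then have gcd_mult_q: "gcd (q * z) n = gcd z n"
    using coprime by (simp add: gcd_mult_left_left_cancel coprime_commute)
  then show "indist (q * z) z" by (rule indist_if_gcd_eq)
  have "gcd x M = gcd (gcd x n) M" for x
    using n_eq by (simp add: gcd.assoc)
  then have "gcd (q * z + M) M = gcd (z + M) M" by (metis gcd_mult_q gcd_add1)
  moreover have "\<not> Q dvd q * z + M" "\<not> Q dvd z + M"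
    using Q_dvd_z Q_dvd_add_mult_M_iff [of _ 1] not_prime_dvd_1 by simp_all
  ultimately show "indist (q * z + M) (z + M)" by (intro indist_if_gcd_eq) (simp add: gcd_M)
qed

lemma sum_preimage_eq:
  assumes S_set_T: "S_set T" and c_preimage: "n dvd q * c - z"
  shows "(\<Sum>y\<in>{0..<n}. of_bool (y \<in> T) * delta n (q * y - z))
    = (\<Sum>j\<in>{0..<q}. of_bool (c + j * M \<in> T) :: int)"
proof -
  have "delta n (q * y - z) = (delta M (y - c) :: int)" for y
  proof -
    have "n dvd q * y - z \<longleftrightarrow> n dvd q * (y - c)"
      using dvd_add_right_iff [OF c_preimage, of "q * (y - c)"] by (simp add: right_diff_distrib)
    then show ?thesis using prime_gt_1 by (simp add: delta_def n_eq)
  qed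
  then show ?thesis
    using sum_delta_multiple [of q M "\<lambda>y. of_bool (y \<in> T) :: int" c] prime_gt_1 M_pos
      S_set_periodic [OF S_set_T]
    by (simp flip: n_eq)
qed

lemma prime_dvd_sum_preimage_if_not_Q_dvd:
  assumes S_set_T: "S_set T" and not_Q_dvd_z: "\<not> Q dvd z"
  shows "q dvd (\<Sum>y\<in>{0..<n}. of_bool (y \<in> T) * delta n (q * y - z))"
proof (cases "\<exists>c. n dvd q * c - z")
  case True
  then obtain c where c_preimage: "n dvd q * c - z" by blast
  have "\<not> Q dvd c + j * M" for j
  proof
    assume "Q dvd c + j * M"
    then have "Q dvd q * (c + j * M)" by (rule dvd_mult)
    moreover have "q * (c + j * M) = (q * c - z) + (z + j * n)" by (simp add: n_eq algebra_simps)
    moreover have "Q dvd q * c - z" using Q_dvd_n c_preimage by (rule dvd_trans)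
    ultimately have "Q dvd z + j * n" by (metis dvd_add_right_iff)
    then show False using not_Q_dvd_z Q_dvd_n by (simp add: dvd_add_left_iff)
  qed
  from this [of 0] this have "c + j * M \<in> T \<longleftrightarrow> c \<in> T" for j
    by (intro S_setD [OF S_set_T] indist_if_not_Q_dvd) simp_all
  then show ?thesis using prime_gt_1 by (simp add: sum_preimage_eq [OF S_set_T c_preimage])
qed (simp add: delta_def)

lemma ex_Q_dvd_preimage:
  assumes "Q dvd z"
  obtains c where "Q dvd c" "n dvd q * c - z"
proof -
  obtain w where z_eq: "z = Q * w" using assms by blast
  obtain t where "[q * t = 1] (mod m)" using cong_solve_coprime_int coprime by blast
  then have "m dvd (q * t - 1) * w" by (simp add: cong_iff_dvd_diff)
  moreover have "q * (Q * (t * w)) - z = Q * ((q * t - 1) * w)" by (simp add: z_eq algebra_simps)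
  ultimately have "n dvd q * (Q * (t * w)) - z"
    by (simp add: modulus Q_def mult_dvd_mono del: power_Suc)
  then show thesis using that [of "Q * (t * w)"] by simp
qed

lemma prime_dvd_sum_preimage_iff:
  assumes S_set_T: "S_set T"
  shows "q dvd (\<Sum>y\<in>{0..<n}. of_bool (y \<in> T) * delta n (q * y - z)) \<longleftrightarrow> z \<notin> jump T"
    (is "q dvd ?N \<longleftrightarrow> _")
proof (cases "Q dvd z")
  case True
  then obtain c where Q_dvd_c: "Q dvd c" and c_preimage: "n dvd q * c - z"
    by (rule ex_Q_dvd_preimage)
  have "?N = (\<Sum>j\<in>insert 0 {1..<q}. of_bool (c + j * M \<in> T))"
    unfolding sum_preimage_eq [OF S_set_T c_preimage] using prime_gt_1 by (intro sum.cong) auto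
  also have "\<dots> = of_bool (c \<in> T) + (\<Sum>j\<in>{1..<q}. of_bool (c + j * M \<in> T))" by simp
  also have "(\<Sum>j\<in>{1..<q}. of_bool (c + j * M \<in> T)) = (\<Sum>j\<in>{1..<q}. of_bool (c + M \<in> T) :: int)"
    by (intro sum.cong) (auto simp: add_mult_M_mem_iff [OF S_set_T Q_dvd_c] dest: zdvd_imp_le)
  also have "\<dots> = (q - 1) * of_bool (c + M \<in> T)" using prime_gt_1 by simp
  finally have "q dvd ?N \<longleftrightarrow> (c \<in> T) = (c + M \<in> T)"
    using not_prime_dvd_1 dvd_diff_right_iff [of q q 1] by auto
  also have "\<dots> \<longleftrightarrow> (q * c \<in> T) = (q * c + M \<in> T)"
    using S_setD [OF S_set_T indist_mult_prime(1) [OF Q_dvd_c]]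
      S_setD [OF S_set_T indist_mult_prime(2) [OF Q_dvd_c]]
    by simp
  also have "\<dots> \<longleftrightarrow> (z \<in> T) = (z + M \<in> T)"
    using S_setD [OF S_set_T indist_if_dvd_diff, of "q * c" z]
      S_setD [OF S_set_T indist_if_dvd_diff, of "q * c + M" "z + M"] c_preimage by simp
  also have "\<dots> \<longleftrightarrow> z \<notin> jump T" using True by (simp add: jump_def)
  finally show ?thesis .
next
  case False
  then have "z \<notin> jump T" by (simp add: jump_def)
  then show ?thesis using prime_dvd_sum_preimage_if_not_Q_dvd [OF S_set_T False] by blast
qed

lemma S_set_jump:
  assumes S_set_T: "S_set T"
  shows "S_set (jump T)"
proof -
  define f :: "int \<Rightarrow> int" where "f x = of_bool (x \<in> T)" for x
  have q_prime: "prime (nat q)" and int_nat_q: "int (nat q) = q" using prime prime_gt_1 by simp_all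
  have "f y ^ nat q = of_bool (y \<in> T)" for y
    using prime_gt_1 by (simp add: f_def)
  moreover have "periodic n f" unfolding f_def [abs_def] by (rule S_set_periodic [OF S_set_T])
  ultimately have "[convpow n f (nat q) z
      = (\<Sum>y\<in>{0..<n}. of_bool (y \<in> T) * delta n (q * y - z))] (mod q)" for z
    using convpow_prime_cong [OF n_pos _ q_prime, of f z] int_nat_q by simp
  then have q_dvd_convpow_iff: "q dvd convpow n f (nat q) z \<longleftrightarrow> z \<notin> jump T" for z
    by (rule trans [OF cong_dvd_iff prime_dvd_sum_preimage_iff [OF S_set_T]])
  have "(\<lambda>x. of_int (f x)) \<in> C" using S_set_T by (simp add: S_set_def f_def)
  then have "convpow n (\<lambda>x. of_int (f x)) (nat q) \<in> C" by (rule convpow_mem)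
  then have "indist x y \<Longrightarrow> convpow n f (nat q) x = convpow n f (nat q) y" for x y
    by (auto simp: indist_def convpow_of_int)
  then show ?thesis unfolding S_set_iff using q_dvd_convpow_iff by metis
qed

end

section \<open>Muzychuk's theorem\<close>

context rational_sring_prime
begin

lemma ex_S_divisor_separating_jump:
  assumes "\<not> Q dvd S_hull x"
  obtains k where "S_divisor k" "Q dvd k" "\<And>z. z \<in> jump (basic_set x) \<Longrightarrow> k dvd z"
    "\<And>t. t \<in> basic_set x \<Longrightarrow> \<not> k dvd t"
proof -
  obtain k where S_divisor_k: "S_divisor k" and Q_dvd_k: "Q dvd k"
    and k_largest: "\<And>A. S_set A \<Longrightarrow> A \<subseteq> {x. Q dvd x} \<Longrightarrow> A \<subseteq> {x. k dvd x}"
    using ex_largest_S_subgroup [OF Q_dvd_n] by blast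
  show thesis
  proof
    show "k dvd z" if "z \<in> jump (basic_set x)" for z
      using k_largest [OF S_set_jump [OF S_set_basic_set]] that by (auto simp: jump_def)
    show "\<not> k dvd t" if "t \<in> basic_set x" for t
      using dvd_S_hull [OF S_divisor_k, of t] S_hull_cong [of x t] that Q_dvd_k assms dvd_trans
      by (auto simp: basic_set_def)
  qed (fact S_divisor_k Q_dvd_k k_largest)+
qed

lemma S_hull_dvd_Un_jump:
  assumes S_hull_dvd_M: "S_hull x dvd M" and jump_disjoint: "basic_set x \<inter> jump (basic_set x) = {}"
    and z_mem: "z \<in> basic_set x \<union> jump (basic_set x)"
  shows "S_hull x dvd z"
proof -
  have S_hull_dvd_basic_set: "S_hull x dvd t" if "t \<in> basic_set x" for t
    using that S_hull_dvd [of t] S_hull_cong [of x t] by (simp add: basic_set_def)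
  show ?thesis
  proof (cases "z \<in> basic_set x")
    case False
    then have "z + M \<in> basic_set x" using z_mem jump_disjoint by (auto simp: jump_def)
    then show ?thesis using S_hull_dvd_basic_set S_hull_dvd_M by (metis dvd_add_left_iff)
  qed (rule S_hull_dvd_basic_set)
qed

lemma dvd_lcm_stabilizer_Un_jump:
  assumes trivial: "\<And>a. (\<And>t. t \<in> T \<Longrightarrow> t - a \<in> T) \<Longrightarrow> n dvd a"
    and stabilizer: "\<And>a. f dvd a \<longleftrightarrow> (\<forall>t\<in>T \<union> jump T. t - a \<in> T \<union> jump T)"
    and l_dvd_jump: "\<And>z. z \<in> jump T \<Longrightarrow> l dvd z" and not_l_dvd_T: "\<And>t. t \<in> T \<Longrightarrow> \<not> l dvd t"
  shows "n dvd lcm l f"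
proof (rule trivial)
  fix t assume t_mem: "t \<in> T"
  then have "t - lcm l f \<in> T \<union> jump T" using stabilizer [of "lcm l f"] by simp
  moreover have "\<not> l dvd t - lcm l f" using not_l_dvd_T [OF t_mem] by (simp add: dvd_diff_left_iff)
  ultimately show "t - lcm l f \<in> T" using l_dvd_jump by blast
qed

lemma gcd_stabilizer_Un_jump:
  assumes S_hull_dvd_M: "S_hull x dvd M" and jump_disjoint: "basic_set x \<inter> jump (basic_set x) = {}"
    and y_jump: "y \<in> jump (basic_set x)" and S_divisor_f: "S_divisor f" and f_dvd_M: "f dvd M"
    and y_minus_f_mem: "y - f \<in> basic_set x \<union> jump (basic_set x)"
  shows "gcd (S_hull y) f = S_hull x"
proof (rule zdvd_antisym_nonneg)
  have "indist x (y + M)" using y_jump jump_disjoint by (auto simp: jump_def basic_set_def)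
  moreover have "gcd (S_hull y) f dvd y + M"
    using S_hull_dvd [of y] f_dvd_M by (meson dvd_add dvd_trans gcd_dvd1 gcd_dvd2)
  ultimately show "gcd (S_hull y) f dvd S_hull x"
    using dvd_S_hull [OF S_divisor_gcd [OF S_divisor_S_hull S_divisor_f]] S_hull_cong by metis
  have "S_hull x dvd y - f" "S_hull x dvd y"
    using S_hull_dvd_Un_jump [OF S_hull_dvd_M jump_disjoint] y_jump y_minus_f_mem by blast+
  then have "S_hull x dvd f" "S_hull x dvd S_hull y"
    using dvd_S_hull [OF S_divisor_S_hull] by (simp_all add: dvd_diff_right_iff)
  then show "S_hull x dvd gcd (S_hull y) f" by simp
qed (simp_all add: S_hull_def)

lemma jump_nonempty:
  assumes S_set_T: "S_set T" and jump_disjoint: "T \<inter> jump T = {}"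
    and trivial: "\<And>a. (\<And>t. t \<in> T \<Longrightarrow> t - a \<in> T) \<Longrightarrow> n dvd a"
  shows "jump T \<noteq> {}"
proof -
  have "\<not> n dvd M" using M_pos M_less zdvd_not_zless by blast
  then show ?thesis
    using trivial [of M] minus_M_mem_Un_jump [OF S_set_T jump_disjoint] by blast
qed

text \<open>The S-set \<open>jump T\<close> of the basic set \<open>T\<close> of \<open>x\<close> is disjoint from \<open>T\<close>, and the stabilizer \<open>f\<close>
  of their union contains \<open>M\<close>. For \<open>y\<close> in \<open>jump T\<close> and \<open>k = S_hull y\<close>, the S-subgroups generated by
  \<open>f\<close> and \<open>k\<close> together span the one generated by \<open>T\<close>, and they intersect trivially. Hence
  \<open>k - f\<close> generates the latter, too.\<close>

lemma indist_S_hull_if_prime_index: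
  assumes S_hull_dvd_M: "S_hull x dvd M" and not_Q_dvd_S_hull: "\<not> Q dvd S_hull x"
    and trivial: "\<And>a. (\<And>t. t \<in> basic_set x \<Longrightarrow> t - a \<in> basic_set x) \<Longrightarrow> n dvd a"
    and IH: "\<And>y. S_hull x < S_hull y \<Longrightarrow> indist y (S_hull y)"
  shows "indist x (S_hull x)"
proof -
  define T where "T = basic_set x"
  have S_set_T: "S_set T" by (simp add: T_def S_set_basic_set)
  obtain l where S_divisor_l: "S_divisor l" and Q_dvd_l: "Q dvd l"
    and l_dvd_jump: "\<And>z. z \<in> jump T \<Longrightarrow> l dvd z" and not_l_dvd_T: "\<And>t. t \<in> T \<Longrightarrow> \<not> l dvd t"
    using ex_S_divisor_separating_jump [OF not_Q_dvd_S_hull] unfolding T_def by blast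
  then have jump_disjoint: "T \<inter> jump T = {}" by blast
  have "S_set (T \<union> jump T)" using S_set_T S_set_jump by (simp add: S_set_iff)
  then obtain f where S_divisor_f: "S_divisor f"
    and f_stabilizer: "\<And>a. f dvd a \<longleftrightarrow> (\<forall>t\<in>T \<union> jump T. t - a \<in> T \<union> jump T)"
    using ex_stabilizer by blast
  have "f dvd M" unfolding f_stabilizer
    using minus_M_mem_Un_jump [OF S_set_T jump_disjoint] by blast
  obtain y where y_jump: "y \<in> jump T"
    using jump_nonempty [OF S_set_T jump_disjoint] trivial unfolding T_def by blast
  define k where "k = S_hull y"
  have "l dvd k" using dvd_S_hull [OF S_divisor_l] l_dvd_jump [OF y_jump] by (simp add: k_def)
  have gcd_k_f: "gcd k f = S_hull x"
    unfolding k_def using gcd_stabilizer_Un_jump [OF S_hull_dvd_M _ _ S_divisor_f \<open>f dvd M\<close>]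
      jump_disjoint y_jump f_stabilizer [of f]
    by (simp add: T_def)
  have "S_hull x \<noteq> k" using not_Q_dvd_S_hull Q_dvd_l \<open>l dvd k\<close> dvd_trans by blast
  moreover have "S_hull x dvd k" by (simp flip: gcd_k_f)
  ultimately have "S_hull x < S_hull y"
    using zdvd_imp_le [of "S_hull x" k] S_divisor_S_hull [of y] by (simp add: k_def S_divisor_def)
  then have "k \<in> jump T"
    using IH S_setD [OF S_set_jump [OF S_set_T]] y_jump unfolding k_def by blast
  have "n dvd lcm l f" using trivial f_stabilizer l_dvd_jump not_l_dvd_T
    unfolding T_def by (rule dvd_lcm_stabilizer_Un_jump)
  also have "lcm l f dvd lcm k f" using \<open>l dvd k\<close> by (simp add: lcm_least dvd_lcmI1)
  finally have gcd_diff: "gcd (k - f) n = S_hull x"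
    using gcd_minus_eq_gcd [of k f n] gcd_k_f S_divisor_S_hull [of x] by (simp add: S_divisor_def)
  have "k - f \<in> T \<union> jump T" using f_stabilizer [of f] \<open>k \<in> jump T\<close> by simp
  moreover have "k - f \<notin> jump T"
    using not_Q_dvd_S_hull Q_dvd_n gcd_diff gcd_greatest [of Q "k - f" n] by (auto simp: jump_def)
  moreover have "indist (k - f) (S_hull x)"
    using gcd_diff by (intro indist_if_gcd_eq) (simp flip: gcd_diff)
  ultimately show ?thesis using S_setD [OF S_set_T] unfolding T_def basic_set_def by blast
qed

end

lemma (in rational_sring) ex_prime_S_hull_dvd:
  assumes "S_hull x \<noteq> n"
  obtains q m e where "rational_sring_prime n C q m e" "S_hull x dvd rational_sring_prime.M q m e"
    "\<not> rational_sring_prime.Q q e dvd S_hull x"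
proof -
  define h where "h = S_hull x"
  have h_pos: "0 < h" and h_dvd_n: "h dvd n"
    using S_divisor_S_hull [of x] by (simp_all add: h_def S_divisor_def)
  obtain c where n_eq_mult: "n = h * c" using h_dvd_n by blast
  have "0 < c" using h_pos n_pos by (simp add: n_eq_mult zero_less_mult_iff)
  moreover have "c \<noteq> 1" using assms n_eq_mult by (metis h_def mult.right_neutral)
  ultimately obtain q where q_prime: "prime q" and "q dvd c"
    using prime_divisor_exists [of c] by auto
  then have "h * q dvd n" by (simp add: n_eq_mult)
  then have "q dvd n" by (rule dvd_mult_right)
  then obtain e m where "n = q ^ Suc e * m" "coprime q m"
    using prime_power_part [OF q_prime] n_pos by (metis less_irrefl)
  then interpret rational_sring_prime n C q m e
    using q_prime by unfold_locales
  have "h dvd M" using \<open>h * q dvd n\<close> prime_gt_1 by (simp add: n_eq mult.commute)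
  moreover have "\<not> Q dvd h"
  proof
    assume "Q dvd h"
    then have "Q * q dvd Q * m"
      using mult_dvd_mono [OF _ dvd_refl] \<open>h * q dvd n\<close>
      unfolding modulus Q_def by (blast intro: dvd_trans)
    then have "q dvd m" using prime_gt_1 by (simp add: Q_def)
    then show False using coprime_common_divisor [OF coprime dvd_refl] not_prime_dvd_1 by blast
  qed
  ultimately show thesis using that rational_sring_prime_axioms by (simp add: h_def)
qed

context rational_sring
begin

lemma indist_S_hull_if_trivial_stabilizer:
  assumes trivial: "\<And>a. (\<And>t. t \<in> basic_set x \<Longrightarrow> t - a \<in> basic_set x) \<Longrightarrow> n dvd a"
    and IH: "\<And>y. S_hull x < S_hull y \<Longrightarrow> indist y (S_hull y)"
  shows "indist x (S_hull x)"
proof (cases "S_hull x = n")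
  case True
  then show ?thesis using S_hull_dvd [of x] by (auto intro: indist_if_dvd_diff)
next
  case False
  then obtain q m e where "rational_sring_prime n C q m e"
      "S_hull x dvd rational_sring_prime.M q m e" "\<not> rational_sring_prime.Q q e dvd S_hull x"
    by (rule ex_prime_S_hull_dvd)
  then show ?thesis using trivial IH by (rule rational_sring_prime.indist_S_hull_if_prime_index)
qed

lemma S_hull_dvd_stabilizer:
  assumes "x - l \<in> basic_set x"
  shows "S_hull x dvd l"
proof -
  have "S_hull x dvd x - l" "S_hull x dvd x"
    using assms S_hull_cong [of x "x - l"] S_hull_dvd [of x] S_hull_dvd [of "x - l"]
    by (simp_all add: basic_set_def)
  then show ?thesis by (simp add: dvd_diff_right_iff)
qed

lemma S_hull_quotient:
  assumes S_divisor_l: "S_divisor l" and S_hull_dvd_l: "S_hull x dvd l"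
  shows "rational_sring.S_hull l {f \<in> C. periodic l f} x = S_hull x"
proof (rule zdvd_antisym_nonneg)
  interpret quotient: rational_sring l "{f \<in> C. periodic l f}" by (rule quotient [OF S_divisor_l])
  have S_divisor_iff: "quotient.S_divisor g \<longleftrightarrow> S_divisor g \<and> g dvd l" for g
    using S_divisor_l periodic_dvd [OF periodic_delta, of g l]
    by (auto simp: quotient.S_divisor_def quotient.S_set_def S_divisor_def S_set_def
      delta_def [abs_def]
        intro: dvd_trans)
  show "quotient.S_hull x dvd S_hull x"
    using quotient.S_divisor_S_hull quotient.S_hull_dvd
    by (intro dvd_S_hull) (simp_all add: S_divisor_iff)
  show "S_hull x dvd quotient.S_hull x"
    using S_divisor_S_hull S_hull_dvd S_hull_dvd_l
    by (intro quotient.dvd_S_hull) (simp_all add: S_divisor_iff)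
  show "0 \<le> quotient.S_hull x" by (simp add: quotient.S_hull_def)
qed (simp add: S_hull_def)

end

theorem rational_sring_indist_S_hull:
  assumes "rational_sring n C"
  shows "rational_sring.indist C x (rational_sring.S_hull n C x)"
  using assms
proof (induction "nat (n - rational_sring.S_hull n C x)" arbitrary: n C x rule: less_induct)
  case less
  interpret rational_sring n C by (rule less.prems)
  define T where "T = basic_set x"
  have S_set_T: "S_set T" by (simp add: T_def S_set_basic_set)
  have x_mem: "x \<in> T" by (simp add: T_def basic_set_def indist_refl)
  obtain l where S_divisor_l: "S_divisor l" and l_stabilizer: "\<And>a. l dvd a \<longleftrightarrow> (\<forall>t\<in>T. t - a \<in> T)"
    using ex_stabilizer [OF S_set_T] by blast
  show ?case
  proof (cases "l = n")
    case True
    show ?thesis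
    proof (rule indist_S_hull_if_trivial_stabilizer)
      show "n dvd a" if "\<And>t. t \<in> basic_set x \<Longrightarrow> t - a \<in> basic_set x" for a
        using l_stabilizer [of a] that by (simp add: True T_def)
      show "indist y (S_hull y)" if "S_hull x < S_hull y" for y
        using that S_divisor_le [OF S_divisor_S_hull, of y] less.hyps rational_sring_axioms by simp
    qed
  next
    case False
    then have "l < n" using S_divisor_le [OF S_divisor_l] by simp
    interpret quotient: rational_sring l "{f \<in> C. periodic l f}" by (rule quotient [OF S_divisor_l])
    have "S_hull x dvd l"
      using l_stabilizer [of l] x_mem by (intro S_hull_dvd_stabilizer) (simp add: T_def)
    then have S_hull_eq: "quotient.S_hull x = S_hull x" by (rule S_hull_quotient [OF S_divisor_l])
    have "quotient.indist x (quotient.S_hull x)"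
      using \<open>l < n\<close> S_divisor_le [OF S_divisor_S_hull, of x] quotient.rational_sring_axioms
        zdvd_imp_le [OF \<open>S_hull x dvd l\<close>] quotient.n_pos
      by (intro less.hyps) (simp_all add: S_hull_eq)
    moreover have "periodic l (\<lambda>y. of_bool (y \<in> T) :: rat)"
      using l_stabilizer [of l] l_stabilizer [of "- l"] by (auto simp: periodic_def)
    ultimately have "S_hull x \<in> T"
      using S_set_T x_mem by (auto simp: quotient.indist_def S_hull_eq S_set_def)
    then show ?thesis by (simp add: T_def basic_set_def)
  qed
qed

lemma ex_delta_combination:
  fixes f :: "int \<Rightarrow> 'a :: comm_ring_1"
  assumes "finite D" and "\<And>h. h \<in> D \<Longrightarrow> 0 < h"
  shows "\<exists>c. \<forall>k\<in>D. f k = (\<Sum>h\<in>D. c h * delta h k)"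
  using assms
proof (induction D rule: finite_linorder_max_induct)
  case (insert b A)
  obtain c where c_combination: "\<forall>k\<in>A. f k = (\<Sum>h\<in>A. c h * delta h k)" using insert by auto
  define c' where "c' = c(b := f b - (\<Sum>h\<in>A. c h * delta h b))"
  have b_notin_A: "b \<notin> A" using insert.hyps(2) by blast
  have "(\<Sum>h\<in>insert b A. c' h * delta h k) = c' b * delta b k + (\<Sum>h\<in>A. c h * delta h k)" for k
  proof -
    have "(\<Sum>h\<in>A. c' h * delta h k) = (\<Sum>h\<in>A. c h * delta h k)"
      using b_notin_A by (intro sum.cong) (auto simp: c'_def)
    then show ?thesis using insert.hyps(1) b_notin_A by simp
  qed
  moreover have "delta b k = (0 :: 'a)" if "k \<in> A" for k
    using that insert.hyps(2) insert.prems by (simp add: delta_def zdvd_not_zless)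
  moreover have "delta b b = (1 :: 'a)" by (simp add: delta_def)
  ultimately have "\<forall>k\<in>insert b A. f k = (\<Sum>h\<in>insert b A. c' h * delta h k)"
    using c_combination by (auto simp: c'_def)
  then show ?case by blast
qed simp

theorem (in rational_sring) ex_S_divisor_combination:
  assumes f_mem: "f \<in> C"
  shows "\<exists>c. \<forall>x. f x = (\<Sum>h | S_divisor h. c h * delta h x)"
proof -
  have "finite {h. S_divisor h}"
    by (rule finite_subset [of _ "{0..n}"]) (auto simp: S_divisor_le S_divisor_def less_imp_le)
  then have "\<exists>c. \<forall>k\<in>{h. S_divisor h}. f k = (\<Sum>h | S_divisor h. c h * delta h k)"
    by (rule ex_delta_combination) (simp add: S_divisor_def)
  then obtain c where c_combination: "\<And>k. S_divisor k \<Longrightarrow> f k = (\<Sum>h | S_divisor h. c h * delta h k)"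
    by blast
  have "f x = (\<Sum>h | S_divisor h. c h * delta h x)" for x
  proof -
    have indist_S_hull: "indist x (S_hull x)"
      by (rule rational_sring_indist_S_hull [OF rational_sring_axioms])
    then have "f x = f (S_hull x)" using f_mem by (auto simp: indist_def)
    also have "\<dots> = (\<Sum>h | S_divisor h. c h * delta h (S_hull x))"
      by (rule c_combination [OF S_divisor_S_hull])
    also have "\<dots> = (\<Sum>h | S_divisor h. c h * delta h x)"
      using S_divisor_dvd_iff [OF _ indist_S_hull] by (intro sum.cong) (auto simp: delta_def)
    finally show ?thesis .
  qed
  then show ?thesis by blast
qed

section \<open>Idempotents of the rational group ring\<close>

lemma ex_common_denominator:
  fixes f :: "'a \<Rightarrow> rat"
  assumes "finite A"
  shows "\<exists>N::int. 0 < N \<and> (\<forall>a\<in>A. of_int N * f a \<in> \<int>)"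
  using assms
proof (induction A)
  case empty
  show ?case by (rule exI [of _ 1]) simp
next
  case (insert a A)
  then obtain N where N_pos: "0 < N" and N_denominator: "\<forall>a\<in>A. of_int N * f a \<in> \<int>" by blast
  obtain c d where "quotient_of (f a) = (c, d)" by force
  then have d_pos: "0 < d" and f_a_eq: "f a = of_int c / of_int d"
    using quotient_of_denom_pos quotient_of_div by auto
  have "of_int (N * d) * f a = of_int (N * c)" using d_pos f_a_eq by simp
  then have "of_int (N * d) * f a \<in> \<int>" by (metis Ints_of_int)
  moreover have "of_int (N * d) * f b \<in> \<int>" if "b \<in> A" for b
  proof -
    have "of_int (N * d) * f b = of_int d * (of_int N * f b)" by simp
    then show ?thesis using N_pos N_denominator that by (metis Ints_mult Ints_of_int)
  qed
  ultimately show ?case using N_pos N_denominator d_pos f_a_eq by (intro exI [of _ "N * d"]) auto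
qed

lemma invariant_mult_if_prime_invariant:
  fixes f :: "int \<Rightarrow> 'a"
  assumes prime_invariant: "\<And>p x. prime p \<Longrightarrow> coprime (int p) L \<Longrightarrow> f (int p * x) = f x"
  shows "0 < u \<Longrightarrow> coprime (int u) L \<Longrightarrow> f (int u * x) = f x"
proof (induction u arbitrary: x rule: prime_divisors_induct)
  case (factor p u)
  then show ?case using prime_invariant [of p "int u * x"] by (simp add: mult.assoc)
qed simp_all

lemma gcd_invariant_if_large_prime_invariant:
  assumes n_pos: "0 < n" and f_periodic: "periodic n f"
    and large_prime_invariant: "\<And>p x. prime p \<Longrightarrow> K < p \<Longrightarrow> f (int p * x) = f x"
  shows "gcd_invariant n f"
proof (rule gcd_invariantI [OF n_pos f_periodic])
  define L where "L = n * fact K"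
  have L_pos: "0 < L" using n_pos by (simp add: L_def)
  have coprime_prime_invariant: "f (int p * x) = f x" if p_prime: "prime p"
    and p_coprime_L: "coprime (int p) L" for p x
  proof (rule large_prime_invariant [OF p_prime])
    have "\<not> int p dvd fact K"
      using p_prime p_coprime_L by (auto simp: L_def dest: coprime_common_divisor)
    then have "\<not> p dvd fact K" by (metis of_nat_dvd_iff of_nat_fact)
    then show "K < p" using p_prime by (simp add: prime_dvd_fact_iff)
  qed
  fix u x :: int assume "coprime u n"
  then obtain t where "coprime (u + n * t) L" using exists_coprime_shift [of u n L] L_pos by auto
  then have "coprime ((u + n * t) mod L + L) L"
    by (metis coprime_iff_gcd_eq_1 gcd.commute gcd_add1 gcd_red_int)
  moreover define v where "v = nat ((u + n * t) mod L + L)"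
  have v_eq: "int v = (u + n * t) mod L + L" using L_pos by (simp add: v_def)
  ultimately have "f (int v * x) = f x"
    using L_pos by (intro invariant_mult_if_prime_invariant [of L f, OF coprime_prime_invariant])
      (simp_all add: v_def add_nonneg_pos)
  moreover have "f (u * x) = f (int v * x)"
  proof (rule periodicD [OF f_periodic])
    have "[int v = u] (mod n)" by (simp add: v_eq L_def cong_def mod_mod_cancel)
    then show "n dvd u * x - int v * x"
      by (metis cong_iff_dvd_diff cong_scalar_right cong_sym)
  qed
  ultimately show "f (u * x) = f x" by simp
qed

lemma convpow_eq_scale_imp_prime_cong:
  fixes b :: "int \<Rightarrow> int"
  assumes n_pos: "0 < n" and b_periodic: "periodic n b"
    and convpow_eq: "\<And>k x. convpow n b (Suc k) x = N ^ k * b x"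
    and p_prime: "prime p" and p_coprime_n: "coprime (int p) n" and not_p_dvd_N: "\<not> int p dvd N"
  shows "[b (int p * x) = b x] (mod int p)"
proof -
  obtain k where p_eq_Suc: "p = Suc k" using prime_gt_0_nat [OF p_prime] not0_implies_Suc by blast
  have "delta n (int p * y - int p * x) = (delta n (y - x) :: int)" for y
    using p_coprime_n by (simp add: delta_def coprime_commute coprime_dvd_mult_right_iff
      flip: right_diff_distrib)
  then have "(\<Sum>y\<in>{0..<n}. b y ^ p * delta n (int p * y - int p * x)) = b x ^ p"
    using sum_delta_periodic [OF n_pos periodic_comp [OF b_periodic, of "\<lambda>z. z ^ p"]] by simp
  then have "[N ^ k * b (int p * x) = b x ^ p] (mod int p)"
    using convpow_prime_cong [OF n_pos b_periodic p_prime, of "int p * x"] convpow_eq [of k]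
      p_eq_Suc by simp
  then have "[N ^ p * b (int p * x) = N * b x ^ p] (mod int p)"
    by (simp add: p_eq_Suc mult.assoc cong_scalar_left del: power_Suc)
      (simp add: cong_scalar_left mult.assoc)
  moreover have "[a ^ p = a] (mod int p)" for a
    using prime_dvd_int_power_diff [OF p_prime] by (simp add: cong_iff_dvd_diff)
  ultimately have "[N * b (int p * x) = N * b x] (mod int p)"
    by (meson cong_mult cong_refl cong_sym cong_trans)
  moreover have "coprime N (int p)"
    using p_prime p_coprime_n not_p_dvd_N prime_imp_coprime [of "int p" N]
    by (simp add: coprime_commute)
  ultimately show ?thesis by (simp add: cong_mult_lcancel)
qed

lemma ex_integer_multiple:
  fixes f :: "int \<Rightarrow> rat"
  assumes n_pos: "0 < n" and f_periodic: "periodic n f"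
  obtains N :: int and b :: "int \<Rightarrow> int"
  where "0 < N" "periodic n b" "\<And>z. of_int (b z) = of_int N * f z"
proof -
  obtain N :: int where N_pos: "0 < N" and N_denominator: "\<forall>a\<in>{0..<n}. of_int N * f a \<in> \<int>"
    using ex_common_denominator [of "{0..<n}" f] by auto
  define b where "b z = \<lfloor>of_int N * f z\<rfloor>" for z
  have "of_int (b z) = of_int N * f z" for z
  proof -
    have "of_int N * f (z mod n) \<in> \<int>" using N_denominator n_pos by simp
    then show ?thesis by (simp add: periodic_mod [OF f_periodic] b_def)
  qed
  moreover have "periodic n b" unfolding b_def [abs_def] by (rule periodic_comp [OF f_periodic])
  ultimately show thesis using that N_pos by blast
qed

lemma periodic_ex_abs_bound:
  fixes b :: "int \<Rightarrow> 'a :: linordered_idom"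
  assumes n_pos: "0 < n" and b_periodic: "periodic n b"
  obtains B where "0 \<le> B" "\<And>z. \<bar>b z\<bar> \<le> B"
proof
  have "\<bar>b (z mod n)\<bar> \<le> (\<Sum>y\<in>{0..<n}. \<bar>b y\<bar>)" for z
    using n_pos by (intro member_le_sum) auto
  then show "\<bar>b z\<bar> \<le> (\<Sum>y\<in>{0..<n}. \<bar>b y\<bar>)" for z
    by (simp add: periodic_mod [OF b_periodic])
qed (simp add: sum_nonneg)

theorem idempotent_gcd_invariant:
  fixes e :: "int \<Rightarrow> rat"
  assumes n_pos: "0 < n" and e_periodic: "periodic n e" and idempotent: "conv n e e = e"
  shows "gcd_invariant n e"
proof -
  obtain N b where N_pos: "0 < N" and b_periodic: "periodic n b"
    and of_int_b: "\<And>z. of_int (b z) = of_int N * e z"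
    by (rule ex_integer_multiple [OF n_pos e_periodic]) blast
  have convpow_b: "convpow n b (Suc k) z = N ^ k * b z" for k z
  proof -
    have "rat_of_int (convpow n b (Suc k) z) = convpow n (\<lambda>z. of_int N * e z) (Suc k) z"
      by (simp only: convpow_of_int [symmetric] of_int_b)
    also have "\<dots> = of_int N ^ Suc k * e z"
      by (simp only: convpow_scale convpow_idempotent [OF n_pos e_periodic idempotent])
    also have "\<dots> = rat_of_int (N ^ k * b z)" by (simp add: of_int_b)
    finally show ?thesis by (simp only: of_int_eq_iff)
  qed
  obtain B where "0 \<le> B" and b_bound: "\<And>z. \<bar>b z\<bar> \<le> B"
    using periodic_ex_abs_bound [OF n_pos b_periodic] by blast
  have "gcd_invariant n b"
  proof (rule gcd_invariant_if_large_prime_invariant [OF n_pos b_periodic])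
    fix p x assume p_prime: "prime p" and p_large: "nat (2 * B + N + n) < p"
    have B_less_p: "2 * B < int p" and N_less_p: "N < int p" and n_less_p: "n < int p"
      using p_large \<open>0 \<le> B\<close> N_pos n_pos by linarith+
    have "\<not> int p dvd N" "\<not> int p dvd n"
      using B_less_p N_less_p n_less_p N_pos n_pos by (simp_all add: zdvd_not_zless)
    then have "[b (int p * x) = b x] (mod int p)"
      using convpow_eq_scale_imp_prime_cong [OF n_pos b_periodic convpow_b p_prime] p_prime
      by (simp add: prime_imp_coprime)
    then have "int p dvd b (int p * x) - b x" by (simp add: cong_iff_dvd_diff)
    moreover have "\<bar>b (int p * x) - b x\<bar> < int p"
      using b_bound [of x] b_bound [of "int p * x"] B_less_p N_less_p n_less_p by linarith
    ultimately have "b (int p * x) - b x = 0" by (metis abs_of_nat dvd_imp_le_int not_le)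
    then show "b (int p * x) = b x" by simp
  qed
  moreover have "e z = of_int (b z) / of_int N" for z using N_pos by (simp add: of_int_b)
  ultimately show ?thesis unfolding gcd_invariant_def by metis
qed

lemma coprime_factors_of_unity_poly:
  fixes g h :: "'a :: field_char_0 poly"
  assumes n_pos: "0 < n" and gh_eq: "g * h = monom 1 n - 1"
  shows "coprime g h"
proof (rule coprimeI)
  fix d assume d_dvd_g: "d dvd g" and d_dvd_h: "d dvd h"
  then have "d dvd pderiv (g * h)" by (simp add: pderiv_mult)
  then have "d dvd monom 1 1 * pderiv (g * h) - smult (of_nat n) (g * h)"
    using d_dvd_g d_dvd_h by (intro dvd_diff dvd_mult dvd_smult) auto
  also have "monom 1 1 * pderiv (g * h) - smult (of_nat n) (g * h) = [:of_nat n:]"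
    using n_pos unfolding gh_eq
    by (simp add: pderiv_diff pderiv_monom mult_monom smult_monom smult_diff_right)
  finally have "d dvd [:of_nat n:]" .
  moreover have "[:of_nat n :: 'a:] dvd 1"
    using n_pos by (simp add: is_unit_const_poly_iff dvd_field_iff)
  ultimately show "d dvd 1" by (rule dvd_trans)
qed

lemma poly_ideal_principal:
  fixes J :: "'a :: field poly set"
  assumes zero_mem: "0 \<in> J" and diff_mem: "\<And>P Q. P \<in> J \<Longrightarrow> Q \<in> J \<Longrightarrow> P - Q \<in> J"
    and mult_mem: "\<And>P R. P \<in> J \<Longrightarrow> R * P \<in> J"
  obtains g where "g \<in> J" "\<And>P. P \<in> J \<Longrightarrow> g dvd P"
proof (cases "J = {0}")
  case False
  then obtain P where "P \<in> J \<and> P \<noteq> 0" using zero_mem by blast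
  then obtain g where g_mem: "g \<in> J \<and> g \<noteq> 0" and g_least: "\<And>P. P \<in> J \<and> P \<noteq> 0 \<Longrightarrow> degree g \<le> degree P"
    using ex_has_least_nat [of "\<lambda>P. P \<in> J \<and> P \<noteq> 0" P degree] by blast
  have "g dvd P" if P_mem: "P \<in> J" for P
  proof -
    have "P mod g \<in> J" using g_mem diff_mem [OF P_mem mult_mem] by (metis minus_div_mult_eq_mod)
    then have "P mod g = 0" using g_least [of "P mod g"] degree_mod_less [of g P] g_mem by force
    then show ?thesis by (rule mod_0_imp_dvd)
  qed
  then show thesis using that g_mem by blast
qed (use that in auto)

lemma coprime_poly_ex_bezout:
  fixes g h :: "'a :: field poly"
  assumes "coprime g h"
  shows "\<exists>u v. u * g + v * h = 1"
proof -
  define J where "J = {u * g + v * h | u v. True}"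
  have combination_mem: "u * g + v * h \<in> J" for u v by (auto simp: J_def)
  obtain d where d_mem: "d \<in> J" and d_dvd: "\<And>P. P \<in> J \<Longrightarrow> d dvd P"
  proof (rule poly_ideal_principal)
    show "0 \<in> J" using combination_mem [of 0 0] by simp
    show "P - R \<in> J" if P_mem: "P \<in> J" and R_mem: "R \<in> J" for P R
    proof -
      obtain u v u' v' where "P = u * g + v * h" "R = u' * g + v' * h"
        using P_mem R_mem by (auto simp: J_def)
      then have "P - R = (u - u') * g + (v - v') * h" by (simp add: left_diff_distrib)
      then show ?thesis using combination_mem by simp
    qed
    show "R * P \<in> J" if P_mem: "P \<in> J" for P R
    proof -
      obtain u v where "P = u * g + v * h" using P_mem by (auto simp: J_def)
      then have "R * P = R * u * g + R * v * h" by (simp add: distrib_left mult.assoc)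
      then show ?thesis using combination_mem by simp
    qed
  qed blast
  have "d dvd g" "d dvd h" using d_dvd combination_mem [of 1 0] combination_mem [of 0 1] by simp_all
  then obtain c where one_eq: "1 = d * c" using assms coprime_common_divisor by blast
  obtain u v where "d = u * g + v * h" using d_mem by (auto simp: J_def)
  then have "(c * u) * g + (c * v) * h = 1" using one_eq by (simp add: algebra_simps)
  then show ?thesis by blast
qed

lemma wrap_mult_mem:
  assumes add: "\<And>f g. f \<in> I \<Longrightarrow> g \<in> I \<Longrightarrow> (\<lambda>x. f x + g x) \<in> I"
    and scale_mem: "\<And>a f. f \<in> I \<Longrightarrow> (\<lambda>x. a * f x) \<in> I"
    and shift_mem: "\<And>f. f \<in> I \<Longrightarrow> (\<lambda>x. f (x - 1)) \<in> I"
    and P_wrap_mem: "wrap n P \<in> I"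
  shows "wrap n (R * P) \<in> I"
proof (induction R)
  case 0
  then show ?case using scale_mem [OF P_wrap_mem, of 0] by (simp add: wrap_0 [abs_def])
next
  case (pCons a R)
  have "wrap n (pCons a R * P) = (\<lambda>z. a * wrap n P z + wrap n (R * P) (z - 1))"
    by (simp add: fun_eq_iff wrap_add wrap_smult wrap_pCons)
  then show ?case using add [OF scale_mem [OF P_wrap_mem] shift_mem [OF pCons.IH]] by simp
qed

lemma wrap_unity_poly: "wrap (int n) (monom 1 n - 1) = (\<lambda>x. 0)"
  by (simp add: fun_eq_iff wrap_diff wrap_monom delta_def dvd_diff_left_iff flip: monom_eq_1)

lemma ex_unity_poly_factor:
  fixes I :: "(int \<Rightarrow> 'a :: field_char_0) set"
  assumes n_pos: "0 < n" and periodic: "\<And>f. f \<in> I \<Longrightarrow> periodic (int n) f"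
    and zero_fun_mem: "(\<lambda>x. 0) \<in> I" and add: "\<And>f g. f \<in> I \<Longrightarrow> g \<in> I \<Longrightarrow> (\<lambda>x. f x + g x) \<in> I"
    and scale_mem: "\<And>a f. f \<in> I \<Longrightarrow> (\<lambda>x. a * f x) \<in> I"
    and shift_mem: "\<And>f. f \<in> I \<Longrightarrow> (\<lambda>x. f (x - 1)) \<in> I"
  obtains g h where "g * h = monom 1 n - 1" "\<And>R. wrap (int n) (R * g) \<in> I"
    "\<And>f. f \<in> I \<Longrightarrow> \<exists>R. wrap (int n) (R * g) = f"
proof -
  let ?w = "wrap (int n) :: 'a poly \<Rightarrow> int \<Rightarrow> 'a"
  define J where "J = {P. ?w P \<in> I}"
  have mult_mem: "R * P \<in> J" if "P \<in> J" for P R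
    using that unfolding J_def mem_Collect_eq
    by (rule wrap_mult_mem [of I, rotated 3]) (auto intro: add scale_mem shift_mem)
  have diff_mem: "P - Q \<in> J" if "P \<in> J" "Q \<in> J" for P Q
    using that add [of "?w P" "\<lambda>x. - 1 * ?w Q x"] scale_mem [of "?w Q" "- 1"]
    by (simp add: J_def wrap_diff [abs_def])
  have "0 \<in> J" and unity_mem: "monom 1 n - 1 \<in> J"
    using zero_fun_mem by (simp_all add: J_def wrap_0 [abs_def] wrap_unity_poly)
  then obtain g where g_mem: "g \<in> J" and g_dvd: "\<And>P. P \<in> J \<Longrightarrow> g dvd P"
    using poly_ideal_principal [of J] diff_mem mult_mem by blast
  obtain h where "monom 1 n - 1 = g * h" using g_dvd [OF unity_mem] by (rule dvdE)
  moreover have "?w (R * g) \<in> I" for R using mult_mem [OF g_mem] by (simp add: J_def)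
  moreover have "\<exists>R. ?w (R * g) = f" if f_mem: "f \<in> I" for f
  proof -
    obtain P where P_wrap: "?w P = f" using n_pos wrap_surj [OF _ periodic [OF f_mem]] by auto
    then have "g dvd P" using g_dvd [of P] f_mem by (simp add: J_def)
    then show ?thesis using P_wrap by (metis dvdE mult.commute)
  qed
  ultimately show thesis using that by metis
qed

text \<open>The polynomial \<open>g\<close> generates the ideal, and it is coprime to its cofactor \<open>h\<close> because
  \<open>X ^ n - 1\<close> is separable. If \<open>u * g + v * h = 1\<close>, then \<open>u * g\<close> is the idempotent.\<close>

theorem ex_idempotent_generator:
  fixes I :: "(int \<Rightarrow> 'a :: field_char_0) set"
  assumes n_pos: "0 < n" and "\<And>f. f \<in> I \<Longrightarrow> periodic (int n) f"
    and "(\<lambda>x. 0) \<in> I" and "\<And>f g. f \<in> I \<Longrightarrow> g \<in> I \<Longrightarrow> (\<lambda>x. f x + g x) \<in> I"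
    and "\<And>a f. f \<in> I \<Longrightarrow> (\<lambda>x. a * f x) \<in> I" and "\<And>f. f \<in> I \<Longrightarrow> (\<lambda>x. f (x - 1)) \<in> I"
  obtains e where "e \<in> I" "\<And>f. f \<in> I \<Longrightarrow> conv (int n) e f = f"
    "\<And>f. periodic (int n) f \<Longrightarrow> conv (int n) e f \<in> I"
proof -
  let ?w = "wrap (int n) :: 'a poly \<Rightarrow> int \<Rightarrow> 'a"
  obtain g h where gh_eq: "g * h = monom 1 n - 1" and g_mult: "\<And>R. ?w (R * g) \<in> I"
      and ex_multiple: "\<And>f. f \<in> I \<Longrightarrow> \<exists>R. ?w (R * g) = f"
    using ex_unity_poly_factor [OF assms] by blast
  obtain u v where bezout: "u * g + v * h = 1"
    using coprime_poly_ex_bezout [OF coprime_factors_of_unity_poly [OF n_pos gh_eq]] by blast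
  have wrap_conv: "?w (P * R) = conv (int n) (?w P) (?w R)" for P R
    using n_pos by (simp add: fun_eq_iff wrap_mult)
  show thesis
  proof
    show "?w (u * g) \<in> I" by (rule g_mult)
    show "conv (int n) (?w (u * g)) f \<in> I" if f_periodic: "periodic (int n) f" for f
    proof -
      obtain P where "?w P = f" using n_pos wrap_surj [OF _ f_periodic] by auto
      then show ?thesis using g_mult [of "P * u"] wrap_conv [of "u * g" P] by (simp add: mult_ac)
    qed
    fix f assume "f \<in> I"
    then obtain R where R_wrap: "?w (R * g) = f" using ex_multiple by blast
    have "R * g = (u * g) * (R * g) + (v * R) * (g * h)"
      using arg_cong [OF bezout, of "\<lambda>c. c * (R * g)"] by (simp add: algebra_simps)
    then have "?w (R * g) = ?w ((u * g) * (R * g) + (v * R) * (g * h))" by (rule arg_cong)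
    also have "\<dots> = (\<lambda>x. ?w ((u * g) * (R * g)) x + ?w ((v * R) * (g * h)) x)"
      by (simp only: fun_eq_iff wrap_add simp_thms)
    also have "\<dots> = conv (int n) (?w (u * g)) f"
      unfolding wrap_conv [of "u * g" "R * g"] wrap_conv [of "v * R" "g * h"] R_wrap
      by (simp add: gh_eq wrap_unity_poly fun_eq_iff conv_def)
    finally show "conv (int n) (?w (u * g)) f = f" by (simp add: R_wrap)
  qed
qed

section \<open>The discrete Fourier transform\<close>

definition additive_char :: "nat \<Rightarrow> int \<Rightarrow> complex" where
  "additive_char n x = cis (2 * pi * of_int x / of_nat n)"

definition dft :: "nat \<Rightarrow> (int \<Rightarrow> rat) \<Rightarrow> nat \<Rightarrow> complex" where
  "dft n f r = (\<Sum>y\<in>{0..<int n}. of_rat (f y) * additive_char n (- (int r * y)))"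

lemma additive_char_add: "additive_char n (x + y) = additive_char n x * additive_char n y"
  by (simp add: additive_char_def cis_mult distrib_left add_divide_distrib)

lemma cnj_additive_char: "cnj (additive_char n x) = additive_char n (- x)"
  by (simp add: additive_char_def cis_cnj)

lemma additive_char_eq_1_iff:
  assumes n_pos: "0 < n"
  shows "additive_char n x = 1 \<longleftrightarrow> int n dvd x"
proof
  assume "additive_char n x = 1"
  then have "cos (2 * pi * of_int x / of_nat n) = 1"
    by (metis additive_char_def cis.sel(1) one_complex.sel(1))
  then obtain k :: int where "2 * pi * of_int x / of_nat n = of_int k * 2 * pi"
    by (auto simp: cos_one_2pi_int)
  then have "real_of_int x = of_int (k * int n)" using n_pos by (simp add: field_simps)
  then show "int n dvd x" by (simp only: of_int_eq_iff dvd_triv_right)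
next
  assume "int n dvd x"
  then obtain k where "x = int n * k" by blast
  then have "2 * pi * of_int x / of_nat n = 2 * pi * of_int k" using n_pos by simp
  then show "additive_char n x = 1" by (simp add: additive_char_def)
qed

lemma periodic_additive_char: "0 < n \<Longrightarrow> periodic (int n) (\<lambda>x. additive_char n (r * x))"
  by (simp add: periodic_def distrib_left additive_char_add)
    (metis additive_char_eq_1_iff dvd_triv_right)

lemma sum_additive_char:
  assumes n_pos: "0 < n"
  shows "(\<Sum>r=1..n. additive_char n (int r * x)) = of_nat n * delta (int n) x"
proof (cases "int n dvd x")
  case True
  then have "additive_char n (int r * x) = 1" for r
    using n_pos by (simp add: additive_char_eq_1_iff)
  then show ?thesis using True by (simp add: delta_def)
next
  case False
  define s where "s = (\<Sum>y\<in>{0..<int n}. additive_char n (x * y))"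
  have "s = (\<Sum>y\<in>{0..<int n}. additive_char n (x * (1 * y + 1)))"
    unfolding s_def using n_pos periodic_additive_char
    by (intro sum_periodic_affine [where h = "\<lambda>y. additive_char n (x * y)", symmetric]) simp_all
  also have "\<dots> = additive_char n x * s"
    by (simp add: s_def sum_distrib_left distrib_left additive_char_add mult.commute)
  finally have "s = 0" using False additive_char_eq_1_iff [OF n_pos] by simp
  moreover have "(\<Sum>r=1..n. additive_char n (x * int r)) = s"
    unfolding s_def using n_pos
      eq_if_dvd_diff_atLeastLessThan [of "int a" 1 "int n" "int b" for a b]
    by (intro sum_periodic_reindex periodic_additive_char) simp_all
  ultimately show ?thesis using False by (simp add: delta_def mult.commute)
qed

lemma dft_inversion:
  assumes n_pos: "0 < n" and f_periodic: "periodic (int n) f"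
  shows "(\<Sum>r=1..n. dft n f r * additive_char n (int r * x)) = of_nat n * of_rat (f x)"
proof -
  have "(\<Sum>r=1..n. dft n f r * additive_char n (int r * x))
      = (\<Sum>r=1..n. \<Sum>y\<in>{0..<int n}. of_rat (f y) * additive_char n (int r * (x - y)))"
    unfolding dft_def sum_distrib_right mult.assoc additive_char_add [symmetric]
    by (simp add: right_diff_distrib)
  also have "\<dots> = (\<Sum>y\<in>{0..<int n}. of_rat (f y) * (\<Sum>r=1..n. additive_char n (int r * (x - y))))"
    by (subst sum.swap) (simp add: sum_distrib_left)
  also have "\<dots> = of_nat n * (\<Sum>y\<in>{0..<int n}. of_rat (f y) * delta (int n) (y - x))"
    unfolding sum_additive_char [OF n_pos]
    by (simp add: sum_distrib_left mult.left_commute delta_minus_commute [of _ x])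
  also have "\<dots> = of_nat n * of_rat (f x)"
    using n_pos f_periodic by (simp add: sum_delta_periodic periodic_comp)
  finally show ?thesis .
qed

lemma dft_eqI:
  assumes n_pos: "0 < n" and f_periodic: "periodic (int n) f" and g_periodic: "periodic (int n) g"
    and dft_eq: "\<And>r. r \<in> {1..n} \<Longrightarrow> dft n f r = dft n g r"
  shows "f = g"
proof
  fix x
  have "of_nat n * of_rat (f x) = (of_nat n * of_rat (g x) :: complex)"
    using dft_inversion [OF n_pos f_periodic, of x] dft_inversion [OF n_pos g_periodic, of x] dft_eq
    by simp
  then show "f x = g x" using n_pos by simp
qed

lemma dft_0: "dft n (\<lambda>x. 0) r = 0"
  by (simp add: dft_def)

lemma dft_diff: "dft n (\<lambda>x. f x - g x) r = dft n f r - dft n g r"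
  by (simp add: dft_def of_rat_diff left_diff_distrib sum_subtractf)

lemma dft_scale: "dft n (\<lambda>x. a * f x) r = of_rat a * dft n f r"
  by (simp add: dft_def of_rat_mult sum_distrib_left mult.assoc)

lemma dft_sum: "dft n (\<lambda>x. \<Sum>a\<in>A. F a x) r = (\<Sum>a\<in>A. dft n (F a) r)"
  unfolding dft_def of_rat_sum sum_distrib_right by (rule sum.swap)

lemma dft_shift:
  assumes n_pos: "0 < n" and f_periodic: "periodic (int n) f"
  shows "dft n (\<lambda>x. f (x - c)) r = additive_char n (- (int r * c)) * dft n f r"
proof -
  have additive_char_shift: "additive_char n (- (int r * (y + c)))
      = additive_char n (- (int r * c)) * additive_char n (- (int r * y))" for y
    by (simp add: algebra_simps flip: additive_char_add)
  let ?h = "\<lambda>y. of_rat (f (y - c)) * additive_char n (- int r * y)"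
  have "dft n (\<lambda>x. f (x - c)) r = (\<Sum>y\<in>{0..<int n}. ?h (1 * y + c))"
    unfolding dft_def using n_pos f_periodic periodic_additive_char [OF n_pos, of "- int r"]
    by (subst sum_periodic_affine [of "int n" ?h])
      (simp_all add: periodic_mult periodic_comp [OF periodic_shift])
  also have "\<dots> = additive_char n (- (int r * c)) * dft n f r"
    by (simp add: additive_char_shift dft_def sum_distrib_left mult.left_commute)
  finally show ?thesis .
qed

lemma dft_conv:
  assumes n_pos: "0 < n" and g_periodic: "periodic (int n) g"
  shows "dft n (conv (int n) f g) r = dft n f r * dft n g r"
proof -
  have "dft n (conv (int n) f g) r = (\<Sum>y\<in>{0..<int n}. of_rat (f y) * dft n (\<lambda>x. g (x - y)) r)"
    unfolding conv_def [abs_def] by (simp add: dft_sum dft_scale)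
  also have "\<dots> = dft n f r * dft n g r"
    by (simp add: dft_shift [OF n_pos g_periodic] dft_def [of n f] sum_distrib_right mult.assoc)
  finally show ?thesis .
qed

lemma dft_eq_0_if_periodic:
  assumes n_pos: "0 < n" and d_dvd_n: "d dvd int n" and f_periodic: "periodic d f"
    and not_dvd_rd: "\<not> int n dvd int r * d"
  shows "dft n f r = 0"
proof -
  have "f (x - d) = f x" for x by (rule periodicD [OF f_periodic]) simp
  then have "dft n f r = additive_char n (- (int r * d)) * dft n f r"
    using dft_shift [OF n_pos periodic_dvd [OF f_periodic d_dvd_n], of d r] by simp
  moreover have "additive_char n (- (int r * d)) \<noteq> 1"
    using not_dvd_rd n_pos by (simp add: additive_char_eq_1_iff)
  ultimately show ?thesis by simp
qed

lemma periodic_iff_dft: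
  assumes n_pos: "0 < n" and d_dvd_n: "d dvd int n" and f_periodic: "periodic (int n) f"
  shows "periodic d f \<longleftrightarrow> (\<forall>r\<in>{1..n}. \<not> int n dvd int r * d \<longrightarrow> dft n f r = 0)"
proof
  assume dft_eq_0: "\<forall>r\<in>{1..n}. \<not> int n dvd int r * d \<longrightarrow> dft n f r = 0"
  have "(\<lambda>x. f (x - d)) = f"
  proof (rule dft_eqI [OF n_pos periodic_shift [OF f_periodic] f_periodic])
    fix r assume "r \<in> {1..n}"
    then show "dft n (\<lambda>x. f (x - d)) r = dft n f r"
      using dft_eq_0 additive_char_eq_1_iff [OF n_pos, of "- (int r * d)"]
      by (cases "int n dvd int r * d") (simp_all add: dft_shift [OF n_pos f_periodic])
  qed
  then have "f (x + d - d) = f (x + d)" for x by (rule fun_cong)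
  then show "periodic d f" by (simp add: periodic_def)
qed (use dft_eq_0_if_periodic [OF n_pos d_dvd_n] in blast)

lemma dft_delta:
  assumes n_pos: "0 < n" and d_pos: "0 < d" and d_dvd_n: "d dvd int n"
  shows "dft n (delta d) r = of_int (int n div d) * of_bool (int n dvd int r * d)"
proof (cases "int n dvd int r * d")
  case True
  have "additive_char n (- (int r * y)) = 1" if "d dvd y" for y
  proof -
    have "int n dvd int r * y" using True that by (meson dvd_refl dvd_trans mult_dvd_mono)
    then show ?thesis using n_pos by (simp add: additive_char_eq_1_iff)
  qed
  then have "dft n (delta d) r = (\<Sum>y\<in>{0..<int n}. delta d y)"
    unfolding dft_def by (intro sum.cong) (auto simp: delta_def)
  also have "\<dots> = of_int (int n div d) * (\<Sum>y\<in>{0..<d}. 1 * delta d (y - 0))"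
    using sum_periodic_dvd [OF d_pos _ d_dvd_n periodic_delta] by simp
  also have "(\<Sum>y\<in>{0..<d}. 1 * delta d (y - 0)) = (1 :: complex)"
    by (rule sum_delta_periodic [OF d_pos]) (simp add: periodic_def)
  finally show ?thesis using True by simp
next
  case False
  then show ?thesis using dft_eq_0_if_periodic [OF n_pos d_dvd_n periodic_delta] by simp
qed

lemma orthogonal_periodic_iff_conv_delta:
  fixes f :: "int \<Rightarrow> 'a :: comm_ring_1"
  assumes d_pos: "0 < d"
  shows "(\<forall>g. periodic d g \<longrightarrow> (\<Sum>y\<in>{0..<n}. f y * g y) = 0) \<longleftrightarrow> (\<forall>x. conv n f (delta d) x = 0)"
proof (intro iffI allI impI)
  fix x assume "\<forall>g. periodic d g \<longrightarrow> (\<Sum>y\<in>{0..<n}. f y * g y) = 0"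
  then show "conv n f (delta d) x = 0"
    unfolding conv_def by (simp add: periodic_reflect [OF periodic_delta])
next
  fix g :: "int \<Rightarrow> 'a"
  assume conv_delta_eq_0: "\<forall>x. conv n f (delta d) x = 0" and g_periodic: "periodic d g"
  have "(\<Sum>y\<in>{0..<n}. f y * g y) = (\<Sum>y\<in>{0..<n}. f y * (\<Sum>c\<in>{0..<d}. g c * delta d (c - y)))"
    by (simp add: sum_delta_periodic [OF d_pos g_periodic])
  also have "\<dots> = (\<Sum>c\<in>{0..<d}. g c * conv n f (delta d) c)"
    unfolding conv_def sum_distrib_left by (subst sum.swap) (simp add: mult.left_commute)
  finally show "(\<Sum>y\<in>{0..<n}. f y * g y) = 0" using conv_delta_eq_0 by simp
qed

lemma orthogonal_periodic_iff_dft: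
  fixes f :: "int \<Rightarrow> rat"
  assumes n_pos: "0 < n" and d_pos: "0 < d" and d_dvd_n: "d dvd int n"
  shows "(\<forall>g. periodic d g \<longrightarrow> (\<Sum>y\<in>{0..<int n}. f y * g y) = 0)
    \<longleftrightarrow> (\<forall>r\<in>{1..n}. int n dvd int r * d \<longrightarrow> dft n f r = 0)"
proof -
  have delta_periodic: "periodic (int n) (delta d)"
    by (rule periodic_dvd [OF periodic_delta d_dvd_n])
  have "(\<forall>g. periodic d g \<longrightarrow> (\<Sum>y\<in>{0..<int n}. f y * g y) = 0)
      \<longleftrightarrow> (\<forall>x. conv (int n) f (delta d) x = 0)"
    by (rule orthogonal_periodic_iff_conv_delta [OF d_pos])
  also have "\<dots> \<longleftrightarrow> (\<forall>r\<in>{1..n}. dft n (conv (int n) f (delta d)) r = 0)"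
  proof
    assume "\<forall>r\<in>{1..n}. dft n (conv (int n) f (delta d)) r = 0"
    then have "conv (int n) f (delta d) = (\<lambda>x. 0)"
      by (intro dft_eqI [OF n_pos periodic_conv [OF delta_periodic]])
        (simp_all add: dft_0 periodic_def)
    then show "\<forall>x. conv (int n) f (delta d) x = 0" by simp
  next
    assume "\<forall>x. conv (int n) f (delta d) x = 0"
    then have "conv (int n) f (delta d) = (\<lambda>x. 0)" by auto
    then show "\<forall>r\<in>{1..n}. dft n (conv (int n) f (delta d)) r = 0" by (simp add: dft_0)
  qed
  also have "\<dots> \<longleftrightarrow> (\<forall>r\<in>{1..n}. int n dvd int r * d \<longrightarrow> dft n f r = 0)"
    using d_pos d_dvd_n dvd_div_eq_0_iff [OF d_dvd_n] n_pos
    by (auto simp: dft_conv [OF n_pos delta_periodic] dft_delta [OF n_pos d_pos d_dvd_n])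
  finally show ?thesis .
qed

lemma ex_dft_eq_avoid:
  assumes n_pos: "0 < n" and "finite A" and "\<And>d. d \<in> A \<Longrightarrow> 0 < d \<and> d dvd int n"
  shows "\<exists>f. periodic (int n) f \<and> (\<forall>r. dft n f r = of_bool (\<forall>d\<in>A. \<not> int n dvd int r * d))"
  using assms(2,3)
proof (induction A)
  case empty
  show ?case
    using n_pos dft_delta [of n "int n"]
    by (intro exI [of _ "delta (int n)"]) (simp add: periodic_delta)
next
  case (insert d A)
  obtain f where f_periodic: "periodic (int n) f"
    and dft_f: "\<And>r. dft n f r = of_bool (\<forall>d\<in>A. \<not> int n dvd int r * d)"
    using insert by auto
  have d_pos: "0 < d" and d_dvd_n: "d dvd int n" using insert.prems by auto
  define g where "g x = f x - inverse (of_int (int n div d)) * conv (int n) (delta d) f x" for x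
  have "int n div d \<noteq> 0" using d_pos d_dvd_n n_pos by (simp add: dvd_div_eq_0_iff)
  moreover have "dft n g r = dft n f r
      - of_rat (inverse (of_int (int n div d))) * (dft n (delta d) r * dft n f r)" for r
    unfolding g_def [abs_def] dft_diff dft_scale dft_conv [OF n_pos f_periodic] ..
  ultimately have "dft n g r = of_bool (\<forall>d\<in>insert d A. \<not> int n dvd int r * d)" for r
    by (simp add: dft_delta [OF n_pos d_pos d_dvd_n] dft_f of_rat_inverse)
  moreover have "periodic (int n) g"
    using f_periodic periodic_conv [OF f_periodic, of "delta d"] by (simp add: g_def periodic_def)
  ultimately show ?case by blast
qed

section \<open>Vectors as periodic functions\<close>

definition vec_of :: "nat \<Rightarrow> (int \<Rightarrow> rat) \<Rightarrow> nat \<Rightarrow> rat" where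
  "vec_of n f i = (if i \<in> {1..n} then f (int i - 1) else 0)"

lemma vec_of_mem_Qvec: "vec_of n f \<in> Qvec n"
  by (auto simp: vec_of_def Qvec_def)

lemma Qvec_cases:
  assumes "0 < n" and v_Qvec: "v \<in> Qvec n"
  obtains f where "periodic (int n) f" "v = vec_of n f"
proof
  define f where "f x = v (nat (x mod int n) + 1)" for x
  show "periodic (int n) f" by (simp add: periodic_def f_def)
  have "v i = f (int i - 1)" if "i \<in> {1..n}" for i
  proof -
    have "(int i - 1) mod int n = int i - 1" using that by simp
    then show ?thesis using that by (simp add: f_def nat_diff_distrib)
  qed
  then show "v = vec_of n f" using v_Qvec by (auto simp: vec_of_def Qvec_def)
qed

lemma sum_positions: "(\<Sum>i=1..n. h (int i - 1)) = (\<Sum>y\<in>{0..<int n}. h y)"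
  by (rule sum.reindex_bij_witness [where i = "\<lambda>y. nat y + 1" and j = "\<lambda>i. int i - 1"]) auto

lemma herm_vec_of: "herm n (vec_of n f) (wvec n r) = dft n f r"
proof -
  have "cnj (wvec n r i) = additive_char n (- (int r * (int i - 1)))" if "i \<in> {1..n}" for i
  proof -
    have "wvec n r i = additive_char n (int r * (int i - 1))"
      using that by (simp add: wvec_def eps_def additive_char_def DeMoivre mult_ac)
    then show ?thesis by (simp add: cnj_additive_char)
  qed
  then have "herm n (vec_of n f) (wvec n r)
      = (\<Sum>i=1..n. of_rat (f (int i - 1)) * additive_char n (- (int r * (int i - 1))))"
    unfolding herm_def by (intro sum.cong) (simp_all add: vec_of_def)
  also have "\<dots> = dft n f r"
    unfolding dft_def by (rule sum_positions)
  finally show ?thesis .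
qed

lemma qinner_vec_of: "qinner n (vec_of n f) (vec_of n g) = (\<Sum>y\<in>{0..<int n}. f y * g y)"
  unfolding qinner_def sum_positions [symmetric] by (intro sum.cong) (simp_all add: vec_of_def)

lemma Qvec_eqI_herm:
  assumes n_pos: "0 < n" and v_Qvec: "v \<in> Qvec n" and w_Qvec: "w \<in> Qvec n"
    and herm_eq: "\<And>r. r \<in> {1..n} \<Longrightarrow> herm n v (wvec n r) = herm n w (wvec n r)"
  shows "v = w"
proof -
  obtain f g where "periodic (int n) f" "v = vec_of n f" "periodic (int n) g" "w = vec_of n g"
    using Qvec_cases [OF n_pos] v_Qvec w_Qvec by metis
  then show ?thesis using dft_eqI [OF n_pos, of f g] herm_eq by (simp add: herm_vec_of)
qed

lemma Vper_iff:
  assumes n_pos: "0 < n" and d_dvd_n: "d dvd n"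
  shows "v \<in> Vper n d \<longleftrightarrow>
    v \<in> Qvec n \<and> (\<forall>i\<in>{1..n}. \<forall>j\<in>{1..n}. int d dvd int i - int j \<longrightarrow> v i = v j)"
proof -
  let ?r = "\<lambda>i. (i - 1) mod d + 1"
  have "0 < d" "d \<le> n" using n_pos d_dvd_n by (auto intro: dvd_imp_le gr0I)
  have residue_position: "?r i \<in> {1..n}" for i
  proof -
    have "(i - 1) mod d < d" using \<open>0 < d\<close> by simp
    then have "?r i \<le> n" using \<open>d \<le> n\<close> by linarith
    then show ?thesis by simp
  qed
  have "int d dvd int i - int j \<longleftrightarrow> ?r i = ?r j" if "i \<in> {1..n}" "j \<in> {1..n}" for i j
  proof -
    have "int i - int j = int (i - 1) - int (j - 1)" using that by auto
    then have "int d dvd int i - int j \<longleftrightarrow> int (i - 1) mod int d = int (j - 1) mod int d"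
      by (simp add: mod_eq_dvd_iff)
    then show ?thesis by (simp flip: zmod_int)
  qed
  moreover from this [OF _ residue_position] have "int d dvd int i - int (?r i)" if "i \<in> {1..n}"
    for i
    using that by simp
  ultimately have "(\<forall>i\<in>{1..n}. v i = v (?r i))
      \<longleftrightarrow> (\<forall>i\<in>{1..n}. \<forall>j\<in>{1..n}. int d dvd int i - int j \<longrightarrow> v i = v j)"
    using residue_position by metis
  then show ?thesis by (simp add: Vper_def)
qed

lemma vec_of_mem_Vper_iff:
  assumes n_pos: "0 < n" and d_dvd_n: "d dvd n" and f_periodic: "periodic (int n) f"
  shows "vec_of n f \<in> Vper n d \<longleftrightarrow> periodic (int d) f"
proof
  assume "periodic (int d) f"
  then have "f (int i - 1) = f (int j - 1)" if "int d dvd int i - int j" for i j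
    using that by (auto elim: periodicD)
  then show "vec_of n f \<in> Vper n d"
    by (simp add: Vper_iff [OF n_pos d_dvd_n] vec_of_mem_Qvec vec_of_def)
next
  assume vec_of_Vper: "vec_of n f \<in> Vper n d"
  have "f (x + int d) = f x" for x
  proof -
    define pos where "pos y = nat (y mod int n) + 1" for y
    have int_pos: "int (pos y) = y mod int n + 1" for y using n_pos by (simp add: pos_def)
    have pos_position: "pos y \<in> {1..n}" for y
      using n_pos pos_mod_bound [of "int n" y] pos_mod_sign [of "int n" y] int_pos [of y]
      unfolding atLeastAtMost_iff by linarith
    have vec_pos: "vec_of n f (pos y) = f y" for y
      using pos_position [of y] by (simp add: vec_of_def int_pos periodic_mod [OF f_periodic])
    have "int d dvd (x + int d) mod int n - x mod int n"
      using d_dvd_n by (simp add: mod_eq_dvd_iff [symmetric] mod_mod_cancel)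
    then have "vec_of n f (pos (x + int d)) = vec_of n f (pos x)"
      using vec_of_Vper pos_position by (simp add: Vper_iff [OF n_pos d_dvd_n] int_pos)
    then show ?thesis by (simp only: vec_pos)
  qed
  then show "periodic (int d) f" by (simp add: periodic_def)
qed

lemma Vper_eq_imp_dvd_diff:
  assumes n_pos: "0 < n" and d_dvd_n: "d dvd n"
    and i_position: "i \<in> {1..n}" and j_position: "j \<in> {1..n}"
    and Vper_eq: "\<And>v. v \<in> Vper n d \<Longrightarrow> v i = v j"
  shows "int d dvd int i - int j"
proof -
  define f :: "int \<Rightarrow> rat" where "f x = delta (int d) (x - (int j - 1))" for x
  have f_periodic: "periodic (int d) f"
    unfolding f_def [abs_def] by (rule periodic_shift [OF periodic_delta])
  moreover have "periodic (int n) f" using periodic_dvd [OF f_periodic] d_dvd_n by simp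
  ultimately have "vec_of n f \<in> Vper n d" by (simp only: vec_of_mem_Vper_iff [OF n_pos d_dvd_n])
  then have "vec_of n f i = vec_of n f j" by (rule Vper_eq)
  then show ?thesis using i_position j_position by (simp add: vec_of_def f_def delta_def)
qed

lemma Vper_iff_herm:
  assumes n_pos: "0 < n" and d_dvd_n: "d dvd n" and v_Qvec: "v \<in> Qvec n"
  shows "v \<in> Vper n d \<longleftrightarrow> (\<forall>r\<in>{1..n}. \<not> n dvd r * d \<longrightarrow> herm n v (wvec n r) = 0)"
proof -
  obtain f where f_periodic: "periodic (int n) f" and v_eq: "v = vec_of n f"
    by (rule Qvec_cases [OF n_pos v_Qvec])
  have "int n dvd int r * int d \<longleftrightarrow> n dvd r * d" for r by (metis of_nat_dvd_iff of_nat_mult)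
  then show ?thesis
    using periodic_iff_dft [OF n_pos _ f_periodic, of "int d"] d_dvd_n
    by (simp add: v_eq vec_of_mem_Vper_iff [OF n_pos d_dvd_n f_periodic] herm_vec_of)
qed

lemma orthogonal_Vper_iff_herm:
  assumes n_pos: "0 < n" and d_dvd_n: "d dvd n" and v_Qvec: "v \<in> Qvec n"
  shows "(\<forall>w\<in>Vper n d. qinner n v w = 0) \<longleftrightarrow> (\<forall>r\<in>{1..n}. n dvd r * d \<longrightarrow> herm n v (wvec n r) = 0)"
proof -
  obtain f where v_eq: "v = vec_of n f" by (rule Qvec_cases [OF n_pos v_Qvec])
  have "0 < d" using n_pos d_dvd_n by (auto intro: gr0I)
  have "Vper n d = vec_of n ` {g. periodic (int d) g}"
  proof (intro equalityI subsetI)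
    fix w assume w_Vper: "w \<in> Vper n d"
    then have "w \<in> Qvec n" by (simp add: Vper_def)
    then obtain g where "periodic (int n) g" "w = vec_of n g" by (rule Qvec_cases [OF n_pos])
    then show "w \<in> vec_of n ` {g. periodic (int d) g}"
      using w_Vper vec_of_mem_Vper_iff [OF n_pos d_dvd_n] by blast
  next
    fix w assume "w \<in> vec_of n ` {g. periodic (int d) g}"
    then obtain g where g_periodic: "periodic (int d) g" and w_eq: "w = vec_of n g" by blast
    then have "periodic (int n) g" using d_dvd_n by (simp add: periodic_dvd)
    then show "w \<in> Vper n d" using g_periodic w_eq vec_of_mem_Vper_iff [OF n_pos d_dvd_n] by blast
  qed
  then have "(\<forall>w\<in>Vper n d. qinner n v w = 0)
      \<longleftrightarrow> (\<forall>g. periodic (int d) g \<longrightarrow> (\<Sum>y\<in>{0..<int n}. f y * g y) = 0)"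
    by (simp add: v_eq qinner_vec_of)
  also have "\<dots> \<longleftrightarrow> (\<forall>r\<in>{1..n}. n dvd r * d \<longrightarrow> herm n v (wvec n r) = 0)"
  proof -
    have "int n dvd int r * int d \<longleftrightarrow> n dvd r * d" for r by (metis of_nat_dvd_iff of_nat_mult)
    then show ?thesis
      using orthogonal_periodic_iff_dft [OF n_pos, of "int d"] d_dvd_n \<open>0 < d\<close>
      by (simp add: v_eq herm_vec_of)
  qed
  finally show ?thesis .
qed

lemma herm_sum: "herm n (\<lambda>i. \<Sum>a\<in>A. u a i) w = (\<Sum>a\<in>A. herm n (u a) w)"
  unfolding herm_def of_rat_sum sum_distrib_right by (rule sum.swap)

lemma qsubspaceD:
  assumes "qsubspace n W"
  shows "W \<subseteq> Qvec n" and "(\<lambda>i. 0) \<in> W"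
    and "\<And>v w. v \<in> W \<Longrightarrow> w \<in> W \<Longrightarrow> (\<lambda>i. v i + w i) \<in> W"
    and "\<And>c v. v \<in> W \<Longrightarrow> (\<lambda>i. c * v i) \<in> W"
  using assms by (simp_all add: qsubspace_def)

lemma qsubspace_sum:
  assumes W_subspace: "qsubspace n W" and "\<And>a. a \<in> A \<Longrightarrow> u a \<in> W"
  shows "(\<lambda>i. \<Sum>a\<in>A. u a i) \<in> W"
  using assms(2) by (induction A rule: infinite_finite_induct) (auto
    intro: qsubspaceD [OF W_subspace])

lemma qsubspace_Qvec: "qsubspace n (Qvec n)"
  by (simp add: qsubspace_def Qvec_def)

lemma qsubspace_Vper: "qsubspace n (Vper n d)"
  by (auto simp: qsubspace_def Vper_def Qvec_def)

lemma qsubspace_Inter: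
  assumes nonempty: "\<W> \<noteq> {}" and \<W>: "\<And>W. W \<in> \<W> \<Longrightarrow> qsubspace n W"
  shows "qsubspace n (\<Inter>\<W>)"
  unfolding qsubspace_def
proof (intro conjI ballI allI InterI)
  show "\<Inter>\<W> \<subseteq> Qvec n" using nonempty qsubspaceD(1) [OF \<W>] by blast
qed (use qsubspaceD(2-4) [OF \<W>] in blast)+

lemma qsubspace_Ud: "qsubspace n (Ud n G d)"
  using qsubspaceD [OF qsubspace_Vper]
  by (auto simp: qsubspace_def Ud_def qinner_def distrib_right sum.distrib mult.assoc
      simp flip: sum_distrib_left)

definition sum_space :: "'a set \<Rightarrow> ('a \<Rightarrow> (nat \<Rightarrow> rat) set) \<Rightarrow> (nat \<Rightarrow> rat) set" where
  "sum_space A U = {(\<lambda>i. \<Sum>a\<in>A. u a i) | u. \<forall>a\<in>A. u a \<in> U a}"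

lemma sum_spaceI: "(\<And>a. a \<in> A \<Longrightarrow> u a \<in> U a) \<Longrightarrow> (\<lambda>i. \<Sum>a\<in>A. u a i) \<in> sum_space A U"
  by (auto simp: sum_space_def)

lemma sum_spaceE:
  assumes "v \<in> sum_space A U"
  obtains u where "v = (\<lambda>i. \<Sum>a\<in>A. u a i)" "\<And>a. a \<in> A \<Longrightarrow> u a \<in> U a"
  using assms by (auto simp: sum_space_def)

lemma sum_space_subset:
  assumes "qsubspace n W" and "\<And>a. a \<in> A \<Longrightarrow> U a \<subseteq> W"
  shows "sum_space A U \<subseteq> W"
  using assms by (auto elim!: sum_spaceE intro!: qsubspace_sum)

lemma qsubspace_sum_space:
  assumes U_subspace: "\<And>a. a \<in> A \<Longrightarrow> qsubspace n (U a)"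
  shows "qsubspace n (sum_space A U)"
  unfolding qsubspace_def
proof (intro conjI ballI allI)
  show "sum_space A U \<subseteq> Qvec n"
    using qsubspaceD(1) [OF U_subspace] by (intro sum_space_subset [OF qsubspace_Qvec])
  show "(\<lambda>i. 0) \<in> sum_space A U"
    using sum_spaceI [of A "\<lambda>a i. 0" U] qsubspaceD(2) [OF U_subspace] by simp
next
  fix v w assume "v \<in> sum_space A U" "w \<in> sum_space A U"
  then obtain u u' where "v = (\<lambda>i. \<Sum>a\<in>A. u a i)" "w = (\<lambda>i. \<Sum>a\<in>A. u' a i)"
    "\<And>a. a \<in> A \<Longrightarrow> u a \<in> U a" "\<And>a. a \<in> A \<Longrightarrow> u' a \<in> U a"
    by (auto elim!: sum_spaceE)
  then show "(\<lambda>i. v i + w i) \<in> sum_space A U"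
    using sum_spaceI [of A "\<lambda>a i. u a i + u' a i" U] qsubspaceD(3) [OF U_subspace]
    by (simp add: sum.distrib)
next
  fix c v assume "v \<in> sum_space A U"
  then obtain u where "v = (\<lambda>i. \<Sum>a\<in>A. u a i)" "\<And>a. a \<in> A \<Longrightarrow> u a \<in> U a"
    by (auto elim!: sum_spaceE)
  then show "(\<lambda>i. c * v i) \<in> sum_space A U"
    using sum_spaceI [of A "\<lambda>a i. c * u a i" U] qsubspaceD(4) [OF U_subspace]
    by (simp add: sum_distrib_left)
qed

lemma G_invariant_sum_space:
  assumes "\<And>a. a \<in> A \<Longrightarrow> G_invariant G (U a)"
  shows "G_invariant G (sum_space A U)"
  unfolding G_invariant_def
proof (intro ballI)
  fix \<sigma> v assume "\<sigma> \<in> G" "v \<in> sum_space A U"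
  then obtain u where "v = (\<lambda>i. \<Sum>a\<in>A. u a i)" "\<And>a. a \<in> A \<Longrightarrow> u a \<in> U a"
    by (auto elim!: sum_spaceE)
  then show "perm_act \<sigma> v \<in> sum_space A U"
    using sum_spaceI [of A "\<lambda>a. perm_act \<sigma> (u a)" U] assms \<open>\<sigma> \<in> G\<close>
    by (simp add: perm_act_def G_invariant_def)
qed

lemma V_delta_least: "qsubspace n W \<Longrightarrow> G_invariant G W \<Longrightarrow> \<delta> \<in> W \<Longrightarrow> V_delta n G \<delta> \<subseteq> W"
  by (auto simp: V_delta_def)

lemma mem_V_delta: "\<delta> \<in> V_delta n G \<delta>"
  by (simp add: V_delta_def)

lemma G_invariant_V_delta: "G_invariant G (V_delta n G \<delta>)"
  by (simp add: V_delta_def G_invariant_def)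

section \<open>The S-ring of a permutation group containing the full cycle\<close>

lemma gcd_invariant_comp2:
  "gcd_invariant n f \<Longrightarrow> gcd_invariant n g \<Longrightarrow> gcd_invariant n (\<lambda>x. \<Phi> (f x) (g x))"
  unfolding gcd_invariant_def by metis

lemma gcd_invariant_conv:
  fixes f g :: "int \<Rightarrow> 'a :: comm_ring_1"
  assumes n_pos: "0 < n" and f_gcd_invariant: "gcd_invariant n f"
    and g_gcd_invariant: "gcd_invariant n g"
  shows "gcd_invariant n (conv n f g)"
proof (rule gcd_invariantI [OF n_pos periodic_conv])
  note per = periodic_if_gcd_invariant
  show "periodic n g" by (rule per [OF g_gcd_invariant])
  fix u x :: int assume u_coprime: "coprime u n"
  have "conv n f g (u * x) = (\<Sum>y\<in>{0..<n}. f (u * y + 0) * g (u * x - (u * y + 0)))"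
    unfolding conv_def
    by (rule sum_periodic_affine
      [OF n_pos
          periodic_mult [OF per [OF f_gcd_invariant]
              periodic_reflect [OF per [OF g_gcd_invariant]]] u_coprime, symmetric])
  also have "\<dots> = conv n f g x"
    by (simp add: conv_def gcd_invariant_mult_unit [OF f_gcd_invariant u_coprime]
      gcd_invariant_mult_unit [OF g_gcd_invariant u_coprime]
        flip: right_diff_distrib)
  finally show "conv n f g (u * x) = conv n f g x" .
qed

lemma conv_positions:
  assumes n_pos: "0 < n" and f_periodic: "periodic (int n) f" and g_periodic: "periodic (int n) g"
  shows "conv (int n) f g (a - b) = (\<Sum>k=1..n. f (a - int k) * g (int k - b))"
proof -
  let ?h = "\<lambda>y. f y * g (a - b - y)"
  have "(\<Sum>k=1..n. ?h (a - int k)) = (\<Sum>y\<in>{0..<int n}. ?h y)"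
  proof (rule sum_periodic_reindex)
    show "periodic (int n) ?h" by (intro periodic_mult f_periodic periodic_reflect g_periodic)
    fix k l assume "k \<in> {1..n}" "l \<in> {1..n}" "int n dvd (a - int k) - (a - int l)"
    then have "int k = int l"
      by (intro eq_if_dvd_diff_atLeastLessThan [of _ 1 "int n"]) (auto simp: dvd_diff_commute)
    then show "k = l" by simp
  qed (use n_pos in auto)
  then show ?thesis by (simp add: conv_def algebra_simps)
qed

text \<open>Convolution with \<open>e\<close> is a projection onto \<open>W\<close>, viewed as a space of periodic functions.\<close>

definition projection_kernel :: "nat \<Rightarrow> (nat \<Rightarrow> rat) set \<Rightarrow> (int \<Rightarrow> rat) \<Rightarrow> bool" where
  "projection_kernel n W e \<longleftrightarrow> periodic (int n) e \<and>
    (\<forall>f. periodic (int n) f \<longrightarrow> vec_of n (conv (int n) e f) \<in> W) \<and>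
    (\<forall>f. periodic (int n) f \<longrightarrow> vec_of n f \<in> W \<longrightarrow> conv (int n) e f = f)"

lemma projection_kernelD:
  assumes "projection_kernel n W e"
  shows "periodic (int n) e"
    and "\<And>f. periodic (int n) f \<Longrightarrow> vec_of n (conv (int n) e f) \<in> W"
    and "\<And>f. periodic (int n) f \<Longrightarrow> vec_of n f \<in> W \<Longrightarrow> conv (int n) e f = f"
  using assms by (simp_all add: projection_kernel_def)

lemma projection_kernel_shift_mem:
  assumes n_pos: "0 < n" and e_kernel: "projection_kernel n W e"
  shows "vec_of n (\<lambda>x. e (x - c)) \<in> W"
proof -
  have "delta (int n) (x - y - c) = (delta (int n) (y - (x - c)) :: rat)" for x y
    using delta_minus_commute [of "int n" "x - c" y] by (simp add: algebra_simps)
  then have "conv (int n) e (\<lambda>x. delta (int n) (x - c)) x = e (x - c)" for x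
    using n_pos projection_kernelD(1) [OF e_kernel] by (simp add: conv_def sum_delta_periodic)
  then have "(\<lambda>x. e (x - c)) = conv (int n) e (\<lambda>x. delta (int n) (x - c))" by auto
  then show ?thesis using projection_kernelD(2) [OF e_kernel periodic_shift [OF periodic_delta]]
    by simp
qed

lemma projection_kernel_gcd_invariant:
  assumes n_pos: "0 < n" and e_kernel: "projection_kernel n W e"
  shows "gcd_invariant (int n) e"
proof -
  note per = projection_kernelD(1) [OF e_kernel]
  have "conv (int n) e e = e"
    using projection_kernelD(3) [OF e_kernel per]
      projection_kernel_shift_mem [OF n_pos e_kernel, of 0] by simp
  then show ?thesis using n_pos per by (intro idempotent_gcd_invariant) simp_all
qed

lemma projection_kernel_apply:
  assumes n_pos: "0 < n" and e_kernel: "projection_kernel n W e" and W_subset_Qvec: "W \<subseteq> Qvec n"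
    and w_mem: "w \<in> W" and i_position: "i \<in> {1..n}"
  shows "w i = (\<Sum>k=1..n. e (int i - int k) * w k)"
proof -
  obtain f where f_periodic: "periodic (int n) f" and w_eq: "w = vec_of n f"
    using Qvec_cases [OF n_pos] W_subset_Qvec w_mem by blast
  then have "conv (int n) e f (int i - 1) = f (int i - 1)"
    using projection_kernelD(3) [OF e_kernel f_periodic] w_mem by simp
  then show ?thesis
    using i_position f_periodic w_eq
      conv_positions [OF n_pos projection_kernelD(1) [OF e_kernel] f_periodic, of "int i" 1]
      by (simp add: vec_of_def)
qed

definition diff_invariant :: "nat \<Rightarrow> (nat \<Rightarrow> nat) set \<Rightarrow> (int \<Rightarrow> 'a) \<Rightarrow> bool" where
  "diff_invariant n G f \<longleftrightarrow>
    (\<forall>\<sigma>\<in>G. \<forall>i\<in>{1..n}. \<forall>j\<in>{1..n}. f (int (\<sigma> i) - int (\<sigma> j)) = f (int i - int j))"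

lemma diff_invariantD:
  "diff_invariant n G f \<Longrightarrow> \<sigma> \<in> G \<Longrightarrow> i \<in> {1..n} \<Longrightarrow> j \<in> {1..n} \<Longrightarrow>
    f (int (\<sigma> i) - int (\<sigma> j)) = f (int i - int j)"
  by (simp add: diff_invariant_def)

lemma diff_invariant_comp2:
  "diff_invariant n G f \<Longrightarrow> diff_invariant n G g \<Longrightarrow> diff_invariant n G (\<lambda>x. \<Phi> (f x) (g x))"
  by (simp add: diff_invariant_def)

locale perm_group =
  fixes n :: nat and G :: "(nat \<Rightarrow> nat) set"
  assumes degree_pos: "0 < n" and subgroup: "subgroup G (sym_group n)"
begin

lemma G_permutes: "\<sigma> \<in> G \<Longrightarrow> \<sigma> permutes {1..n}"
  using subgroup.mem_carrier [OF subgroup] by (simp add: sym_group_carrier)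

lemma G_inv:
  assumes "\<sigma> \<in> G"
  shows "inv' \<sigma> \<in> G"
proof -
  have sigma_carrier: "\<sigma> \<in> carrier (sym_group n)" by (rule subgroup.mem_carrier [OF subgroup assms])
  have "m_inv (sym_group n) \<sigma> = inv' \<sigma>"
    by (rule group.inv_equality [OF sym_group_is_group])
      (use sigma_carrier sym_group_inv_closed [OF sigma_carrier] permutes_inv_o [of \<sigma> "{1..n}"]
        in \<open>auto simp: sym_group_carrier sym_group_mult sym_group_one\<close>)
  then show ?thesis using subgroup.m_inv_closed [OF subgroup assms] by simp
qed

lemma G_mem: "\<sigma> \<in> G \<Longrightarrow> \<sigma> i \<in> {1..n} \<longleftrightarrow> i \<in> {1..n}"
  by (rule permutes_in_image [OF G_permutes])

lemma G_inverses: "\<sigma> \<in> G \<Longrightarrow> \<sigma> (inv' \<sigma> i) = i" "\<sigma> \<in> G \<Longrightarrow> inv' \<sigma> (\<sigma> i) = i"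
  using permutes_inverses [OF G_permutes] by simp_all

lemma G_inv_inv: "\<sigma> \<in> G \<Longrightarrow> inv' (inv' \<sigma>) = \<sigma>"
  by (rule permutes_inv_inv [OF G_permutes])

lemma sum_permute: "\<sigma> \<in> G \<Longrightarrow> (\<Sum>k=1..n. h (\<sigma> k)) = (\<Sum>k=1..n. h k)"
  using sum.permute [OF G_permutes, of \<sigma> h] by (simp add: comp_def)

lemma diff_invariant_conv:
  assumes f_periodic: "periodic (int n) f" and f_diff_invariant: "diff_invariant n G f"
    and g_periodic: "periodic (int n) g" and g_diff_invariant: "diff_invariant n G g"
  shows "diff_invariant n G (conv (int n) f g)"
  unfolding diff_invariant_def
proof (intro ballI)
  fix \<sigma> i j assume sigma_G: "\<sigma> \<in> G" and i_position: "i \<in> {1..n}" and j_position: "j \<in> {1..n}"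
  have "conv (int n) f g (int (\<sigma> i) - int (\<sigma> j))
      = (\<Sum>k=1..n. f (int (\<sigma> i) - int (\<sigma> k)) * g (int (\<sigma> k) - int (\<sigma> j)))"
    unfolding conv_positions [OF degree_pos f_periodic g_periodic]
    by (rule sum_permute [OF sigma_G, symmetric])
  also have "\<dots> = (\<Sum>k=1..n. f (int i - int k) * g (int k - int j))"
    using diff_invariantD [OF f_diff_invariant sigma_G]
      diff_invariantD [OF g_diff_invariant sigma_G] i_position j_position
    by (intro sum.cong) simp_all
  also have "\<dots> = conv (int n) f g (int i - int j)"
    by (rule conv_positions [OF degree_pos f_periodic g_periodic, symmetric])
  finally show "conv (int n) f g (int (\<sigma> i) - int (\<sigma> j)) = conv (int n) f g (int i - int j)" .
qed

lemma diff_invariant_delta_iff: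
  "diff_invariant n G (delta d :: int \<Rightarrow> 'a :: comm_ring_1) \<longleftrightarrow>
    (\<forall>\<sigma>\<in>G. \<forall>i\<in>{1..n}. \<forall>j\<in>{1..n}. d dvd int i - int j \<longrightarrow> d dvd int (\<sigma> i) - int (\<sigma> j))"
    (is "_ \<longleftrightarrow> ?R")
proof
  assume preserves_cong: ?R
  have "d dvd int (\<sigma> i) - int (\<sigma> j) \<longleftrightarrow> d dvd int i - int j"
    if sigma_G: "\<sigma> \<in> G" and i_position: "i \<in> {1..n}" and j_position: "j \<in> {1..n}" for \<sigma> i j
    using preserves_cong sigma_G i_position j_position G_inv [OF sigma_G] G_mem [OF sigma_G]
      G_inverses(2) [OF sigma_G] by metis
  then show "diff_invariant n G (delta d :: int \<Rightarrow> 'a)" by (simp add: diff_invariant_def delta_def)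
qed (simp add: diff_invariant_def delta_def of_bool_eq_iff)

definition orbital_sring :: "(int \<Rightarrow> rat) set" where
  "orbital_sring = {f. gcd_invariant (int n) f \<and> diff_invariant n G f}"

lemma rational_sring_orbital_sring: "rational_sring (int n) orbital_sring"
proof
  show "0 < int n" using degree_pos by simp
  show "gcd_invariant (int n) f" if "f \<in> orbital_sring" for f
    using that by (simp add: orbital_sring_def)
  show "(\<lambda>_. a) \<in> orbital_sring" for a
    by (simp add: orbital_sring_def gcd_invariant_def diff_invariant_def)
  have "i = j" if "i \<in> {1..n}" "j \<in> {1..n}" "int n dvd int i - int j" for i j
    using that eq_if_dvd_diff_atLeastLessThan [of "int i" 1 "int n" "int j"] by simp
  then have "diff_invariant n G (delta (int n) :: int \<Rightarrow> rat)"
    unfolding diff_invariant_delta_iff by (metis diff_self)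
  then show "delta (int n) \<in> orbital_sring" by (simp add: orbital_sring_def gcd_invariant_delta)
  fix f g assume "f \<in> orbital_sring" "g \<in> orbital_sring"
  then show "(\<lambda>x. f x + g x) \<in> orbital_sring" "(\<lambda>x. f x * g x) \<in> orbital_sring"
      "conv (int n) f g \<in> orbital_sring"
    using degree_pos by (simp_all add: orbital_sring_def gcd_invariant_comp2 diff_invariant_comp2
        gcd_invariant_conv diff_invariant_conv periodic_if_gcd_invariant)
qed

sublocale rational_sring "int n" orbital_sring
  by (rule rational_sring_orbital_sring)

lemma perm_act_Qvec: "\<sigma> \<in> G \<Longrightarrow> v \<in> Qvec n \<Longrightarrow> perm_act \<sigma> v \<in> Qvec n"
  using G_mem [OF G_inv] by (auto simp: Qvec_def perm_act_def)

lemma qsubspace_V_delta: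
  assumes "\<delta> \<in> Qvec n"
  shows "qsubspace n (V_delta n G \<delta>)"
  unfolding V_delta_def
proof (rule qsubspace_Inter)
  have "Qvec n \<in> {W. qsubspace n W \<and> G_invariant G W \<and> \<delta> \<in> W}"
    using assms perm_act_Qvec by (simp add: qsubspace_Qvec G_invariant_def)
  then show "{W. qsubspace n W \<and> G_invariant G W \<and> \<delta> \<in> W} \<noteq> {}" by blast
qed simp

lemma G_invariant_Vper_iff:
  assumes d_dvd_n: "d dvd n"
  shows "G_invariant G (Vper n d) \<longleftrightarrow>
    (\<forall>\<sigma>\<in>G. \<forall>i\<in>{1..n}. \<forall>j\<in>{1..n}. int d dvd int i - int j \<longrightarrow> int d dvd int (\<sigma> i) - int (\<sigma> j))"
    (is "_ \<longleftrightarrow> ?R")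
proof
  assume preserves_cong: ?R
  show "G_invariant G (Vper n d)"
    unfolding G_invariant_def
  proof (intro ballI)
    fix \<sigma> v assume sigma_G: "\<sigma> \<in> G" and v_Vper: "v \<in> Vper n d"
    have "perm_act \<sigma> v i = perm_act \<sigma> v j"
      if "i \<in> {1..n}" "j \<in> {1..n}" "int d dvd int i - int j" for i j
      using that v_Vper preserves_cong G_inv [OF sigma_G] G_mem [OF G_inv [OF sigma_G]]
      unfolding Vper_iff [OF degree_pos d_dvd_n] perm_act_def by blast
    then show "perm_act \<sigma> v \<in> Vper n d"
      using v_Vper perm_act_Qvec [OF sigma_G] unfolding Vper_iff [OF degree_pos d_dvd_n] by blast
  qed
next
  assume Vper_invariant: "G_invariant G (Vper n d)"
  show ?R
  proof (intro ballI impI)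
    fix \<sigma> i j assume sigma_G: "\<sigma> \<in> G" and i_position: "i \<in> {1..n}" and j_position: "j \<in> {1..n}"
      and d_dvd_diff: "int d dvd int i - int j"
    show "int d dvd int (\<sigma> i) - int (\<sigma> j)"
    proof (rule Vper_eq_imp_dvd_diff [OF degree_pos d_dvd_n])
      show "\<sigma> i \<in> {1..n}" "\<sigma> j \<in> {1..n}" using i_position j_position G_mem [OF sigma_G] by blast+
      fix v assume "v \<in> Vper n d"
      then have "perm_act (inv' \<sigma>) v \<in> Vper n d"
        using Vper_invariant G_inv [OF sigma_G] by (simp add: G_invariant_def)
      then have "perm_act (inv' \<sigma>) v i = perm_act (inv' \<sigma>) v j"
        using i_position j_position d_dvd_diff unfolding Vper_iff [OF degree_pos d_dvd_n] by blast
      then show "v (\<sigma> i) = v (\<sigma> j)" by (simp add: perm_act_def G_inv_inv [OF sigma_G])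
    qed
  qed
qed

lemma S_divisor_iff_DG: "S_divisor (int d) \<longleftrightarrow> d \<in> DG n G"
proof (cases "d dvd n")
  case True
  then have "S_divisor (int d) \<longleftrightarrow> delta (int d) \<in> orbital_sring"
    using degree_pos by (auto simp: S_divisor_def S_set_def delta_def [abs_def] intro: gr0I)
  also have "\<dots> \<longleftrightarrow> d \<in> DG n G"
    using True by (simp add: orbital_sring_def DG_def gcd_invariant_delta diff_invariant_delta_iff
      G_invariant_Vper_iff)
  finally show ?thesis .
qed (auto simp: S_divisor_def DG_def)

lemma DG_dvd: "d \<in> DG n G \<Longrightarrow> d dvd n"
  by (simp add: DG_def)

lemma finite_DG: "finite (DG n G)"
  by (rule finite_subset [of _ "{d. d dvd n}"]) (use DG_dvd degree_pos in auto)

lemma DG_gcd: "d \<in> DG n G \<Longrightarrow> h \<in> DG n G \<Longrightarrow> gcd d h \<in> DG n G"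
  using S_divisor_gcd [of "int d" "int h"] by (simp only: S_divisor_iff_DG gcd_int_int_eq)

lemma modulus_mem_DG: "n \<in> DG n G"
  using S_divisor_modulus by (simp only: S_divisor_iff_DG)

lemma qinner_perm_act:
  assumes sigma_G: "\<sigma> \<in> G"
  shows "qinner n (perm_act \<sigma> v) w = qinner n v (perm_act (inv' \<sigma>) w)"
proof -
  have "qinner n (perm_act \<sigma> v) w = (\<Sum>i=1..n. v (inv' \<sigma> i) * w (\<sigma> (inv' \<sigma> i)))"
    by (simp add: qinner_def perm_act_def G_inverses [OF sigma_G])
  also have "\<dots> = qinner n v (perm_act (inv' \<sigma>) w)"
    unfolding qinner_def perm_act_def G_inv_inv [OF sigma_G]
    by (rule sum_permute [OF G_inv [OF sigma_G]])
  finally show ?thesis .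
qed

lemma G_invariant_Ud:
  assumes d_DG: "d \<in> DG n G"
  shows "G_invariant G (Ud n G d)"
  unfolding G_invariant_def
proof (intro ballI)
  fix \<sigma> v assume sigma_G: "\<sigma> \<in> G" and v_Ud: "v \<in> Ud n G d"
  have perm_act_Vper: "perm_act \<tau> w \<in> Vper n h" if "\<tau> \<in> G" "h \<in> DG n G" "w \<in> Vper n h" for \<tau> h w
    using that by (simp add: DG_def G_invariant_def)
  show "perm_act \<sigma> v \<in> Ud n G d"
    using v_Ud d_DG perm_act_Vper [OF sigma_G] perm_act_Vper [OF G_inv [OF sigma_G]]
    by (auto simp: Ud_def qinner_perm_act [OF sigma_G])
qed

lemma Psi_iff:
  assumes "d \<in> DG n G"
  shows "r \<in> Psi n G d \<longleftrightarrow>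
    r \<in> {1..n} \<and> n dvd r * d \<and> (\<forall>d'\<in>DG n G. covers n G d d' \<longrightarrow> \<not> n dvd r * d')"
proof -
  have "n div h dvd r \<longleftrightarrow> n dvd r * h" if "h \<in> DG n G" for h
    using DG_dvd [OF that] degree_pos by (intro div_dvd_iff_mult) auto
  then show ?thesis using assms by (auto simp: Psi_def)
qed

lemma ex_covers_multiple:
  assumes d_DG: "d \<in> DG n G" and g_DG: "g \<in> DG n G" and g_dvd_d: "g dvd d" and g_neq_d: "g \<noteq> d"
  shows "\<exists>l\<in>DG n G. covers n G d l \<and> g dvd l"
proof -
  let ?A = "{l \<in> DG n G. g dvd l \<and> l dvd d \<and> l < d}"
  have finite_chain: "finite ?A" using finite_DG by simp
  have "0 < d" using DG_dvd [OF d_DG] dvd_pos_nat [OF degree_pos] by auto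
  then have "g \<in> ?A" using g_DG g_dvd_d g_neq_d by (simp add: dvd_imp_le le_neq_implies_less)
  then have Max_mem: "Max ?A \<in> ?A" using Max_in [OF finite_chain] by blast
  moreover have "\<not> (\<exists>l\<in>DG n G. Max ?A < l \<and> l < d \<and> Max ?A dvd l \<and> l dvd d)"
  proof
    assume "\<exists>l\<in>DG n G. Max ?A < l \<and> l < d \<and> Max ?A dvd l \<and> l dvd d"
    then obtain l where Max_less_l: "Max ?A < l"
      and "l \<in> DG n G" "l < d" "Max ?A dvd l" "l dvd d" by blast
    then have "l \<in> ?A" using Max_mem dvd_trans by blast
    then show False using Max_ge [OF finite_chain] Max_less_l by fastforce
  qed
  ultimately show ?thesis by (auto simp: covers_def)
qed

lemma Psi_dvd_iff:
  assumes d_DG: "d \<in> DG n G" and r_Psi: "r \<in> Psi n G d" and h_DG: "h \<in> DG n G"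
  shows "n dvd r * h \<longleftrightarrow> d dvd h"
proof
  assume "d dvd h"
  then have "r * d dvd r * h" by simp
  then show "n dvd r * h" using r_Psi Psi_iff [OF d_DG] dvd_trans by blast
next
  assume "n dvd r * h"
  moreover have "n dvd r * d" using r_Psi Psi_iff [OF d_DG] by blast
  ultimately have n_dvd_mult_gcd: "n dvd r * gcd d h" by (simp add: gcd_mult_distrib_nat)
  have "gcd d h = d"
  proof (rule ccontr)
    assume "gcd d h \<noteq> d"
    then obtain l where l_DG: "l \<in> DG n G" and covers_l: "covers n G d l"
      and gcd_dvd_l: "gcd d h dvd l"
      using ex_covers_multiple [OF d_DG DG_gcd [OF d_DG h_DG]] by auto
    then have "n dvd r * l" using n_dvd_mult_gcd by (meson dvd_trans mult_dvd_mono dvd_refl)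
    then show False using r_Psi l_DG covers_l gcd_dvd_l Psi_iff [OF d_DG] by blast
  qed
  then show "d dvd h" by (metis gcd_dvd2)
qed

lemma Psi_unique:
  assumes "d \<in> DG n G" "r \<in> Psi n G d" and "d' \<in> DG n G" "r \<in> Psi n G d'"
  shows "d = d'"
  using assms Psi_dvd_iff Psi_iff by (intro dvd_antisym) blast+

lemma Psi_exists:
  assumes "r \<in> {1..n}"
  shows "\<exists>d\<in>DG n G. r \<in> Psi n G d"
proof -
  define d where "d = (LEAST d. d \<in> DG n G \<and> n dvd r * d)"
  have d_DG: "d \<in> DG n G" and n_dvd_rd: "n dvd r * d"
    using LeastI [of "\<lambda>d. d \<in> DG n G \<and> n dvd r * d" n] modulus_mem_DG by (auto simp: d_def)
  have "\<not> n dvd r * d'" if "d' \<in> DG n G" "d' < d" for d'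
    using not_less_Least [of d' "\<lambda>d. d \<in> DG n G \<and> n dvd r * d"] that by (auto simp: d_def)
  then show ?thesis using d_DG n_dvd_rd assms by (auto simp: Psi_iff covers_def)
qed

lemma Ud_iff_herm:
  assumes d_DG: "d \<in> DG n G"
  shows "v \<in> Ud n G d \<longleftrightarrow> v \<in> Qvec n \<and> (\<forall>r\<in>{1..n} - Psi n G d. herm n v (wvec n r) = 0)"
proof (cases "v \<in> Qvec n")
  case True
  have "v \<in> Ud n G d \<longleftrightarrow> v \<in> Vper n d \<and>
      (\<forall>d'\<in>DG n G. covers n G d d' \<longrightarrow> (\<forall>w\<in>Vper n d'. qinner n v w = 0))"
    by (simp add: Ud_def)
  also have "\<dots> \<longleftrightarrow> (\<forall>r\<in>{1..n}. \<not> n dvd r * d \<longrightarrow> herm n v (wvec n r) = 0) \<and>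
      (\<forall>d'\<in>DG n G. covers n G d d' \<longrightarrow> (\<forall>r\<in>{1..n}. n dvd r * d' \<longrightarrow> herm n v (wvec n r) = 0))"
    using True DG_dvd d_DG degree_pos
    by (simp add: Vper_iff_herm orthogonal_Vper_iff_herm cong: ball_cong)
  also have "\<dots> \<longleftrightarrow> (\<forall>r\<in>{1..n} - Psi n G d. herm n v (wvec n r) = 0)"
    using Psi_iff [OF d_DG] by blast
  finally show ?thesis using True by simp
qed (simp add: Ud_def Vper_def)

lemma ex_Ud_component:
  assumes d_DG: "d \<in> DG n G" and v_Qvec: "v \<in> Qvec n"
  shows "\<exists>u\<in>Ud n G d. \<forall>r\<in>Psi n G d. herm n u (wvec n r) = herm n v (wvec n r)"
proof -
  obtain f where f_periodic: "periodic (int n) f" and v_eq: "v = vec_of n f"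
    by (rule Qvec_cases [OF degree_pos v_Qvec])
  let ?covered = "{d' \<in> DG n G. covers n G d d'}"
  have DG_int: "0 < int h \<and> int h dvd int n" if "h \<in> DG n G" for h
    using DG_dvd [OF that] dvd_pos_nat [OF degree_pos] by auto
  then have "\<exists>g. periodic (int n) g \<and>
      (\<forall>r. dft n g r = of_bool (\<forall>d'\<in>int ` ?covered. \<not> int n dvd int r * d'))"
    using finite_DG by (intro ex_dft_eq_avoid [OF degree_pos]) auto
  then obtain g where "periodic (int n) g"
      and dft_g: "\<And>r. dft n g r = of_bool (\<forall>d'\<in>int ` ?covered. \<not> int n dvd int r * d')" by blast
  define c where "c = inverse (of_int (int n div int d) :: rat)"
  define u where "u x = c * conv (int n) (delta (int d)) (conv (int n) g f) x" for x
  have "c * of_int (int n div int d) = 1"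
    using DG_int [OF d_DG] degree_pos by (simp add: c_def dvd_div_eq_0_iff)
  then have "of_rat c * of_int (int n div int d) = (1 :: complex)"
    by (metis of_rat_1 of_rat_mult of_rat_of_int_eq)
  then have "dft n u r = of_bool (int n dvd int r * int d) * (dft n g r * dft n f r)" for r
    using degree_pos f_periodic DG_int [OF d_DG]
    by (simp add: u_def [abs_def] dft_scale dft_conv periodic_conv dft_delta flip: mult.assoc)
  moreover have "int n dvd int r * int h \<longleftrightarrow> n dvd r * h" for r h
    by (metis of_nat_dvd_iff of_nat_mult)
  ultimately have "dft n u r = of_bool (r \<in> Psi n G d) * dft n f r" if "r \<in> {1..n}" for r
    using that by (auto simp: Psi_iff [OF d_DG] dft_g)
  then show ?thesis
    using vec_of_mem_Qvec
    by (intro bexI [of _ "vec_of n u"]) (auto simp: Ud_iff_herm [OF d_DG] v_eq herm_vec_of Psi_def)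
qed

lemma herm_sum_Ud:
  assumes S_subset_DG: "S \<subseteq> DG n G" and u_Ud: "\<And>d. d \<in> S \<Longrightarrow> u d \<in> Ud n G d"
    and d_DG: "d \<in> DG n G" and r_Psi: "r \<in> Psi n G d"
  shows "herm n (\<lambda>i. \<Sum>d\<in>S. u d i) (wvec n r) = (if d \<in> S then herm n (u d) (wvec n r) else 0)"
proof -
  have "herm n (u d') (wvec n r) = (if d' = d then herm n (u d) (wvec n r) else 0)" if "d' \<in> S"
    for d'
  proof (cases "d' = d")
    case False
    have d'_DG: "d' \<in> DG n G" using S_subset_DG that by blast
    have "r \<in> {1..n} - Psi n G d'"
      using Psi_unique [OF d_DG r_Psi d'_DG] False r_Psi by (auto simp: Psi_def)
    then show ?thesis using False u_Ud [OF that] Ud_iff_herm [OF d'_DG] by simp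
  qed simp
  then have "herm n (\<lambda>i. \<Sum>d\<in>S. u d i) (wvec n r)
      = (\<Sum>d'\<in>S. if d' = d then herm n (u d) (wvec n r) else 0)"
    unfolding herm_sum by (rule sum.cong [OF refl])
  then show ?thesis using finite_subset [OF S_subset_DG finite_DG] by simp
qed

theorem Ud_independent:
  assumes S_subset_DG: "S \<subseteq> DG n G" and u_Ud: "\<And>d. d \<in> S \<Longrightarrow> u d \<in> Ud n G d"
    and sum_eq_0: "(\<lambda>i. \<Sum>d\<in>S. u d i) = (\<lambda>i. 0)" and d_mem: "d \<in> S"
  shows "u d = (\<lambda>i. 0)"
proof (rule Qvec_eqI_herm [OF degree_pos])
  have d_DG: "d \<in> DG n G" using S_subset_DG d_mem by blast
  show "u d \<in> Qvec n" using u_Ud [OF d_mem] Ud_iff_herm [OF d_DG] by blast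
  show "(\<lambda>i. 0) \<in> Qvec n" by (simp add: Qvec_def)
  fix r assume r_position: "r \<in> {1..n}"
  have "herm n (u d) (wvec n r) = 0"
  proof (cases "r \<in> Psi n G d")
    case True
    then show ?thesis using herm_sum_Ud [OF S_subset_DG u_Ud d_DG True] d_mem
      unfolding sum_eq_0 by (simp add: herm_def)
  next
    case False
    then show ?thesis using u_Ud [OF d_mem] r_position Ud_iff_herm [OF d_DG] by blast
  qed
  then show "herm n (u d) (wvec n r) = herm n (\<lambda>i. 0) (wvec n r)" by (simp add: herm_def)
qed

theorem mem_sum_space_Ud:
  assumes v_Qvec: "v \<in> Qvec n" and S_subset_DG: "S \<subseteq> DG n G"
    and support: "\<And>d r. d \<in> DG n G \<Longrightarrow> r \<in> Psi n G d \<Longrightarrow> herm n v (wvec n r) \<noteq> 0 \<Longrightarrow> d \<in> S"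
  shows "v \<in> sum_space S (Ud n G)"
proof -
  obtain u where u_Ud: "\<And>d. d \<in> S \<Longrightarrow> u d \<in> Ud n G d"
      and herm_u: "\<And>d r. d \<in> S \<Longrightarrow> r \<in> Psi n G d \<Longrightarrow> herm n (u d) (wvec n r) = herm n v (wvec n r)"
    using ex_Ud_component [OF _ v_Qvec] S_subset_DG by (metis subsetD)
  have sum_mem_sum_space: "(\<lambda>i. \<Sum>d\<in>S. u d i) \<in> sum_space S (Ud n G)" by (rule sum_spaceI [OF u_Ud])
  have "v = (\<lambda>i. \<Sum>d\<in>S. u d i)"
  proof (rule Qvec_eqI_herm [OF degree_pos v_Qvec])
    show "(\<lambda>i. \<Sum>d\<in>S. u d i) \<in> Qvec n"
      using sum_mem_sum_space
        qsubspaceD(1) [OF qsubspace_sum_space [of S n "Ud n G", OF qsubspace_Ud]] by blast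
    fix r assume "r \<in> {1..n}"
    then obtain d where d_DG: "d \<in> DG n G" and r_Psi: "r \<in> Psi n G d" using Psi_exists by blast
    then show "herm n v (wvec n r) = herm n (\<lambda>i. \<Sum>d\<in>S. u d i) (wvec n r)"
      using herm_sum_Ud [OF S_subset_DG u_Ud d_DG r_Psi] herm_u support by auto
  qed
  then show ?thesis using sum_mem_sum_space by simp
qed

lemma dft_eq_if_Psi:
  assumes f_mem: "f \<in> orbital_sring" and d_DG: "d \<in> DG n G" and r_Psi: "r \<in> Psi n G d"
    and s_Psi: "s \<in> Psi n G d"
  shows "dft n f r = dft n f s"
proof -
  obtain c where c_combination: "\<And>x. f x = (\<Sum>h | S_divisor h. c h * delta h x)"
    using ex_S_divisor_combination [OF f_mem] by blast
  have "dft n (delta h) r = dft n (delta h) s" if S_divisor_h: "S_divisor h" for h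
  proof -
    obtain k where h_eq: "h = int k"
      using S_divisor_h by (metis S_divisor_def int_nat_eq less_imp_le nat_0_le)
    then have "k \<in> DG n G" using S_divisor_h S_divisor_iff_DG by blast
    then have "n dvd r * k \<longleftrightarrow> n dvd s * k" using Psi_dvd_iff [OF d_DG] r_Psi s_Psi by simp
    then have "int n dvd int r * h \<longleftrightarrow> int n dvd int s * h"
      unfolding h_eq by (metis of_nat_dvd_iff of_nat_mult)
    then show ?thesis using S_divisor_h degree_pos by (simp add: dft_delta S_divisor_def)
  qed
  then show ?thesis by (simp add: c_combination [abs_def] dft_sum dft_scale)
qed

lemma projection_kernel_conjugate:
  assumes e_kernel: "projection_kernel n W e" and W_subspace: "qsubspace n W"
    and W_invariant: "G_invariant G W"
    and sigma_G: "\<sigma> \<in> G" and i_position: "i \<in> {1..n}" and j_position: "j \<in> {1..n}"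
  shows "e (int (\<sigma> i) - int (\<sigma> j)) = (\<Sum>k=1..n. e (int i - int k) * e (int (\<sigma> k) - int (\<sigma> j)))"
proof -
  let ?w = "perm_act (inv' \<sigma>) (vec_of n (\<lambda>x. e (x - (int (\<sigma> j) - 1))))"
  have "?w k = e (int (\<sigma> k) - int (\<sigma> j))" if "k \<in> {1..n}" for k
    using that G_mem [OF sigma_G] by (simp add: perm_act_def G_inv_inv [OF sigma_G] vec_of_def)
  moreover have "?w \<in> W"
    using W_invariant G_inv [OF sigma_G] projection_kernel_shift_mem [OF degree_pos e_kernel]
    by (simp add: G_invariant_def)
  ultimately show ?thesis
    using projection_kernel_apply [OF degree_pos e_kernel qsubspaceD(1) [OF W_subspace], of ?w i]
      i_position j_position by simp
qed

text \<open>The matrices \<open>e (i - j)\<close> and \<open>e (\<sigma> i - \<sigma> j)\<close> are symmetric idempotents with the same image,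
  hence equal.\<close>

lemma projection_kernel_mem_orbital_sring:
  assumes e_kernel: "projection_kernel n W e" and W_subspace: "qsubspace n W"
    and W_invariant: "G_invariant G W"
  shows "e \<in> orbital_sring"
proof -
  have gcd_inv: "gcd_invariant (int n) e"
    by (rule projection_kernel_gcd_invariant [OF degree_pos e_kernel])
  have e_symmetric: "e (a - b) = e (b - a)" for a b
    using gcd_invariant_minus [OF gcd_inv, of "a - b"] by simp
  note conjugate = projection_kernel_conjugate [OF e_kernel W_subspace W_invariant]
  have "diff_invariant n G e"
    unfolding diff_invariant_def
  proof (intro ballI)
    fix \<sigma> i j assume sigma_G: "\<sigma> \<in> G" and i_position: "i \<in> {1..n}" and j_position: "j \<in> {1..n}"
    have "e (int (\<sigma> i) - int (\<sigma> j)) = (\<Sum>k=1..n. e (int j - int k) * e (int (\<sigma> k) - int (\<sigma> i)))"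
      using conjugate [OF sigma_G j_position i_position] by (simp add: e_symmetric [of "int (\<sigma> i)"])
    also have "\<dots> = (\<Sum>k=1..n. e (int (\<sigma> i) - int (\<sigma> k)) * e (int (inv' \<sigma> (\<sigma> k)) - int j))"
      by (simp add: e_symmetric [of "int j"] e_symmetric [of _ "int (\<sigma> i)"] G_inverses [OF sigma_G]
        mult.commute)
    also have "\<dots> = (\<Sum>k=1..n. e (int (\<sigma> i) - int k) * e (int (inv' \<sigma> k) - int j))"
      by (rule sum_permute [OF sigma_G])
    also have "\<dots> = e (int i - int j)"
      using conjugate [OF G_inv [OF sigma_G], of "\<sigma> i" "\<sigma> j"] i_position j_position
        G_mem [OF sigma_G]
      by (simp add: G_inverses [OF sigma_G])
    finally show "e (int (\<sigma> i) - int (\<sigma> j)) = e (int i - int j)" .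
  qed
  then show ?thesis using gcd_inv by (simp add: orbital_sring_def)
qed

end

locale cyclic_perm_group = perm_group +
  assumes cycle: "ncycle n \<in> G"
begin

lemma vec_of_shift_eq_perm_act:
  assumes f_periodic: "periodic (int n) f"
  shows "vec_of n (\<lambda>x. f (x - 1)) = perm_act (ncycle n) (vec_of n f)"
proof
  fix i
  let ?j = "inv' (ncycle n) i"
  have ncycle_j: "ncycle n ?j = i" and j_position_iff: "?j \<in> {1..n} \<longleftrightarrow> i \<in> {1..n}"
    using G_inverses(1) [OF cycle] G_mem [OF G_inv [OF cycle]] by blast+
  have "int n dvd int (ncycle n k) - (int k + 1)" if "k \<in> {1..n}" for k
    using that by (auto simp: ncycle_def)
  from this [of ?j] have "int n dvd (int i - 1 - 1) - (int ?j - 1)" if "?j \<in> {1..n}"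
    using that ncycle_j by (simp add: algebra_simps)
  then show "vec_of n (\<lambda>x. f (x - 1)) i = perm_act (ncycle n) (vec_of n f) i"
    using j_position_iff periodicD [OF f_periodic] by (auto simp: vec_of_def perm_act_def)
qed

lemma ex_projection_kernel:
  assumes W_subspace: "qsubspace n W" and W_invariant: "G_invariant G W"
  shows "\<exists>e. projection_kernel n W e"
proof -
  define I where "I = {f. periodic (int n) f \<and> vec_of n f \<in> W}"
  have vec_of_simps: "vec_of n (\<lambda>x. 0) = (\<lambda>i. 0)"
    "vec_of n (\<lambda>x. f x + g x) = (\<lambda>i. vec_of n f i + vec_of n g i)"
    "vec_of n (\<lambda>x. a * f x) = (\<lambda>i. a * vec_of n f i)" for f g a by (auto simp: vec_of_def)
  obtain e where "e \<in> I" "\<And>f. f \<in> I \<Longrightarrow> conv (int n) e f = f"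
      "\<And>f. periodic (int n) f \<Longrightarrow> conv (int n) e f \<in> I"
  proof (rule ex_idempotent_generator [OF degree_pos, of I])
    show "periodic (int n) f" if "f \<in> I" for f using that by (simp add: I_def)
    show "(\<lambda>x. f (x - 1)) \<in> I" if "f \<in> I" for f
      using that W_invariant cycle
      by (simp add: I_def periodic_shift vec_of_shift_eq_perm_act G_invariant_def)
  qed (use qsubspaceD [OF W_subspace] in \<open>auto simp: I_def vec_of_simps periodic_def\<close>)
  then show ?thesis by (auto simp: projection_kernel_def I_def)
qed

theorem Ud_subset_invariant_subspace:
  assumes W_subspace: "qsubspace n W" and W_invariant: "G_invariant G W" and w_mem: "w \<in> W"
    and d_DG: "d \<in> DG n G" and r_Psi: "r \<in> Psi n G d" and nonzero: "herm n w (wvec n r) \<noteq> 0"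
  shows "Ud n G d \<subseteq> W"
proof
  fix v assume v_Ud: "v \<in> Ud n G d"
  obtain e where e_kernel: "projection_kernel n W e"
    using ex_projection_kernel [OF W_subspace W_invariant] by blast
  have "w \<in> Qvec n" "v \<in> Qvec n"
    using w_mem qsubspaceD(1) [OF W_subspace] v_Ud Ud_iff_herm [OF d_DG] by blast+
  then obtain f g where f_periodic: "periodic (int n) f" and w_eq: "w = vec_of n f"
    and g_periodic: "periodic (int n) g" and v_eq: "v = vec_of n g"
    using Qvec_cases [OF degree_pos] by metis
  have "dft n e r * dft n f r = dft n f r"
    using projection_kernelD(3) [OF e_kernel f_periodic] w_mem f_periodic w_eq
      dft_conv [OF degree_pos f_periodic, of e r] by simp
  then have "dft n e r = 1" using nonzero w_eq by (simp add: herm_vec_of)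
  then have e_Psi: "dft n e s = 1" if "s \<in> Psi n G d" for s
    using dft_eq_if_Psi [OF projection_kernel_mem_orbital_sring [OF e_kernel W_subspace W_invariant]
      d_DG that r_Psi] by simp
  have "conv (int n) e g = g"
  proof (rule dft_eqI [OF degree_pos periodic_conv [OF g_periodic] g_periodic])
    fix s assume "s \<in> {1..n}"
    then show "dft n (conv (int n) e g) s = dft n g s"
      using v_Ud e_Psi Ud_iff_herm [OF d_DG, of v]
      by (cases "s \<in> Psi n G d")
        (simp_all add: dft_conv [OF degree_pos g_periodic] v_eq herm_vec_of)
  qed
  then show "v \<in> W" using projection_kernelD(2) [OF e_kernel g_periodic] v_eq by simp
qed

end

theorem theorem4:
  fixes n :: nat and G :: "(nat \<Rightarrow> nat) set" and \<delta> :: "nat \<Rightarrow> rat"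
  assumes "0 < n"
    and "subgroup G (sym_group n)"
    and "ncycle n \<in> G"
    and "\<delta> \<in> Qvec n"
  defines "S \<equiv> {d \<in> DG n G. \<exists>r\<in>Psi n G d. herm n \<delta> (wvec n r) \<noteq> 0}"
  shows "V_delta n G \<delta> = {(\<lambda>i. \<Sum>d\<in>S. u d i) | u. \<forall>d\<in>S. u d \<in> Ud n G d}
    \<and> (\<forall>u. (\<forall>d\<in>S. u d \<in> Ud n G d) \<and> (\<lambda>i. \<Sum>d\<in>S. u d i) = (\<lambda>i. 0)
           \<longrightarrow> (\<forall>d\<in>S. u d = (\<lambda>i. 0)))"
proof -
  interpret cyclic_perm_group n G
    by (intro cyclic_perm_group.intro perm_group.intro cyclic_perm_group_axioms.intro) (fact assms)+
  have S_subset_DG: "S \<subseteq> DG n G" by (auto simp: S_def)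
  have V_delta_subspace: "qsubspace n (V_delta n G \<delta>)"
    using qsubspace_V_delta assms(4) by blast
  have "V_delta n G \<delta> = sum_space S (Ud n G)"
  proof
    have "\<delta> \<in> sum_space S (Ud n G)"
      using S_subset_DG by (rule mem_sum_space_Ud [OF assms(4)]) (auto simp: S_def)
    then show "V_delta n G \<delta> \<subseteq> sum_space S (Ud n G)"
      using S_subset_DG by (intro V_delta_least qsubspace_sum_space qsubspace_Ud
        G_invariant_sum_space G_invariant_Ud) auto
    have "Ud n G d \<subseteq> V_delta n G \<delta>" if "d \<in> S" for d
      using that Ud_subset_invariant_subspace [OF V_delta_subspace G_invariant_V_delta mem_V_delta]
      by (auto simp: S_def)
    then show "sum_space S (Ud n G) \<subseteq> V_delta n G \<delta>"
      by (rule sum_space_subset [OF V_delta_subspace])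
  qed
  then show ?thesis using Ud_independent [OF S_subset_DG] unfolding sum_space_def by blast
qed

end
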